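(* With the exception of $\mathrm{Cay}(\mathbb{Z},\{\pm 1\})$, any Cayley graph $\mathrm{Cay}(B,S)$ of an infinite finitely generated abelian group $B$ with respect to a finite generating set $S$ is quasi-Hamiltonian (with base vertex the identity $e_B$).
   Context: $\mathrm{Cay}(B,S)$ is the undirected, unlabeled simple graph with vertex set $B$ in which distinct $g,g'$ are joined by an edge iff $g=g's$ for some $s\in S\cup S^{-1}$. A path in a graph is a sequence $v_1,\dots,v_n$ of not necessarily distinct vertices with consecutive ones adjacent; its length is $n$. For a graph $\Gamma$, vertices $u,v$ and a finite set $F$ of vertices, $\mathrm{TS}(u,v,F)$ is the minimal length of a path in $\Gamma$ which starts at $u$, ends at $v$ and visits all vertices of $F$. Let $\Gamma$ be an infinite, connected, locally finite graph with a fixed vertex $o$, and let $B_n$ be the ball of radius $n$ centered at $o$. $(\Gamma,o)$ is quasi-Hamiltonian if there is a family $\mathcal F$ of connected finite induced subgraphs of $\Gamma$ such that (1) $o\in F$ for every $F\in\mathcal F$; (2) for every $n\ge1$ there is $F\in\mathcal F$ with $B_n\subseteq F$; (3) there is a constant $M\ge0$ such that $\mathrm{TS}(o,x,F)\le |F|+M$ for all $F\in\mathcal F$ and all $x\in F$. *)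

theory Defs
  imports
    "HOL-Algebra.Generated_Groups"
    "HOL-Algebra.Elementary_Groups"
    "HOL-Library.Extended_Nat"
    "Graph_Theory.Graph_Theory"
begin

text \<open>
  An undirected simple graph is a symmetric loop-free digraph whose arcs are pairs of vertices:
  every edge is represented by its two orientations.
\<close>

definition Cay :: "('a, 'm) monoid_scheme \<Rightarrow> 'a set \<Rightarrow> 'a pair_pre_digraph" where
  "Cay B S = \<lparr> pverts = carrier B,
     parcs = {(g, g'). g \<in> carrier B \<and> g' \<in> carrier B \<and> g \<noteq> g' \<and>
       (\<exists>s \<in> S \<union> m_inv B ` S. g = g' \<otimes>\<^bsub>B\<^esub> s)} \<rparr>"

text \<open>
  Two measures of a path are in use: \<^const>\<open>vwalk_length\<close> counts its edges, as needed for graph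
  distance and balls, whereas the length of a path in \<open>TS\<close> is its number of vertices,
  counted with multiplicity. Walks may repeat vertices.
\<close>

definition graph_ball :: "'a pair_pre_digraph \<Rightarrow> 'a \<Rightarrow> nat \<Rightarrow> 'a set" where
  "graph_ball \<Gamma> u n =
     {v. \<exists>p. vwalk p (with_proj \<Gamma>) \<and> hd p = u \<and> last p = v \<and> vwalk_length p \<le> n}"

text \<open>The walk may leave \<open>F\<close>. The value is \<open>\<infinity>\<close> if there is no such walk.\<close>

definition TS :: "'a pair_pre_digraph \<Rightarrow> 'a \<Rightarrow> 'a \<Rightarrow> 'a set \<Rightarrow> enat" where
  "TS \<Gamma> u v F =
     (INF p \<in> {p. vwalk p (with_proj \<Gamma>) \<and> hd p = u \<and> last p = v \<and> F \<subseteq> set p}. enat (length p))"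

definition locally_finite :: "'a pair_pre_digraph \<Rightarrow> bool" where
  "locally_finite \<Gamma> \<longleftrightarrow> (\<forall>v \<in> pverts \<Gamma>. finite (out_arcs (with_proj \<Gamma>) v))"

text \<open>
  The first five conjuncts are the standing assumptions under which the notion makes sense.
  The finite induced subgraphs in the family are given by their vertex sets.
\<close>

definition quasi_hamiltonian :: "'a pair_pre_digraph \<Rightarrow> 'a \<Rightarrow> bool" where
  "quasi_hamiltonian \<Gamma> v0 \<longleftrightarrow>
     pair_bidirected_digraph \<Gamma> \<and> infinite (pverts \<Gamma>) \<and>
     Digraph_Component.connected (with_proj \<Gamma>) \<and> locally_finite \<Gamma> \<and> v0 \<in> pverts \<Gamma> \<and>
     (\<exists>\<F> :: 'a set set.
        (\<forall>F \<in> \<F>. F \<subseteq> pverts \<Gamma> \<and> finite F \<and>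
           Digraph_Component.connected (induce_subgraph (with_proj \<Gamma>) F)) \<and>
        (\<forall>F \<in> \<F>. v0 \<in> F) \<and>
        (\<forall>n \<ge> 1. \<exists>F \<in> \<F>. graph_ball \<Gamma> v0 n \<subseteq> F) \<and>
        (\<exists>M :: nat. \<forall>F \<in> \<F>. \<forall>x \<in> F. TS \<Gamma> v0 x F \<le> enat (card F + M)))"

end

theory Submission
  imports Defs
begin

text \<open>
  Unless the graph is a line, some generator \<open>s\<close> has infinite order and does not generate \<open>B\<close>. Adding the
  other generators one at a time and snaking through the cosets produces a path \<open>w\<close> of at least two
  representatives of different cosets of \<open>\<langle>s\<rangle>\<close>, and the elements \<open>s [^] i \<otimes> w ! j\<close> with \<open>- n \<le> i < n\<close> form a
  rectangular grid in the Cayley graph. These grids exhaust \<open>B\<close> and are the sets of the family.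

  If \<open>\<langle>s\<rangle>\<close> has finite index, \<open>w\<close> is fixed and the error may depend on its length: from \<open>u\<close> the walk
  covers the columns to the left and comes back, snakes to the column of \<open>v\<close>, covers the columns to the
  right and comes back. If the index is infinite, \<open>w\<close> can be chosen of even length, and the same
  strategy applies to the \<open>2 \<times> 2\<close> squares of the grid arranged along a snake, with a bounded error.
\<close>

text \<open>On a line, a walk that starts and ends in the middle of a long segment must retrace long
  stretches, so its error is unbounded. A second row lets a walk leave along some vertices and
  return along others, which is why \<open>w\<close> needs two vertices. Cutting the grid into
  blocks makes this a local matter: the walk pays extra only in the blocks of its two end points,
  and the error is governed by the block size. Columns therefore suffice while their height is
  fixed. For infinite index the height must grow with the sets, so blocks of bounded size are
  needed, and \<open>2 \<times> 2\<close> squares tile the grid only if both sides are even. Along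
  \<open>s\<close> the number of exponents is chosen as \<open>2 * n\<close>; across, evenness comes
  from a generator of infinite order modulo the earlier ones. For finite index the length of
  \<open>w\<close> is the index, which may be odd. Walks are built between arbitrary
  \<open>u\<close> and \<open>v\<close> because the position of the identity in the grid is not
  controlled.\<close>

definition cov_walk :: "('a \<Rightarrow> 'a \<Rightarrow> bool) \<Rightarrow> 'a set \<Rightarrow> 'a \<Rightarrow> 'a \<Rightarrow> nat \<Rightarrow> bool" where
  "cov_walk E X u v n \<longleftrightarrow>
     (\<exists>p. p \<noteq> [] \<and> hd p = u \<and> last p = v \<and> successively E p \<and> X \<subseteq> set p \<and> length p \<le> n)"

lemma cov_walk_path:
  assumes "successively E p" "p \<noteq> []" "X \<subseteq> set p" "length p \<le> n"
  shows "cov_walk E X (hd p) (last p) n"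
  using assms unfolding cov_walk_def by blast

lemma cov_walk_refl: "X \<subseteq> {u} \<Longrightarrow> 1 \<le> n \<Longrightarrow> cov_walk E X u u n"
  using cov_walk_path[of E "[u]" X n] by simp

lemma cov_walk_mono: "cov_walk E X u v n \<Longrightarrow> Y \<subseteq> X \<Longrightarrow> n \<le> m \<Longrightarrow> cov_walk E Y u v m"
  unfolding cov_walk_def by (blast intro: order_trans)

text \<open>All vertices of both walks are kept and counted once each, so the bounds add without
  loss; this is what allows a chain of any length to cost exactly \<open>k\<close> per block.
  \<open>cov_walk_join\<close> merges the common end point and gives away one vertex, which is
  harmless since it occurs only a fixed number of times in a walk.\<close>

lemma cov_walk_append:
  assumes "cov_walk E X u v n" "E v v'" "cov_walk E Y v' w m"
  shows "cov_walk E (X \<union> Y) u w (n + m)"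
proof -
  from assms obtain p q where "p \<noteq> []" "hd p = u" "last p = v" "successively E p" "X \<subseteq> set p"
    "length p \<le> n" "q \<noteq> []" "hd q = v'" "last q = w" "successively E q" "Y \<subseteq> set q" "length q \<le> m"
    unfolding cov_walk_def by blast
  then show ?thesis using assms(2)
    unfolding cov_walk_def
    by (intro exI[of _ "p @ q"]) (auto simp: successively_append_iff)
qed

lemma cov_walk_join:
  assumes "cov_walk E X u v n" "cov_walk E Y v w m"
  shows "cov_walk E (X \<union> Y) u w (n + m)"
proof -
  from assms obtain p q where p: "p \<noteq> []" "hd p = u" "last p = v" "successively E p" "X \<subseteq> set p"
    "length p \<le> n" and q: "q \<noteq> []" "hd q = v" "last q = w" "successively E q" "Y \<subseteq> set q" "length q \<le> m"
    unfolding cov_walk_def by blast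
  obtain q' where q': "q = v # q'" using q by (cases q) auto
  have "v \<in> set p" using p last_in_set by blast
  then show ?thesis using p q unfolding cov_walk_def q'
    by (intro exI[of _ "p @ q'"])
       (auto simp: successively_append_iff successively_Cons split: if_splits)
qed

lemma cov_walk_sym:
  assumes "symp E" "cov_walk E X u v n"
  shows "cov_walk E X v u n"
proof -
  from assms obtain p where "p \<noteq> []" "hd p = u" "last p = v" "successively E p" "X \<subseteq> set p" "length p \<le> n"
    unfolding cov_walk_def by blast
  then show ?thesis using assms(1) unfolding cov_walk_def
    by (intro exI[of _ "rev p"])
       (auto simp: hd_rev last_rev elim!: successively_mono dest: sympD)
qed

section \<open>Chains of blocks\<close>

text \<open>
  The vertex set is cut into blocks \<open>K b\<close> of at most \<open>k\<close> vertices, linked by the relation \<open>N\<close>.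
  A walk passing through a chain of blocks once may enter a block \<open>b\<close> at any gate in \<open>D b\<close>. A walk making
  an excursion from \<open>a\<close> into the blocks beyond \<open>b\<close> enters and leaves \<open>b\<close> through a pair of ports in
  \<open>T b a\<close>. Both kinds of walk visit every vertex once; only the two blocks that contain the end
  points of the whole walk are traversed several times, at a cost controlled by \<open>c\<close>.
\<close>

locale block_graph =
  fixes E :: "'a \<Rightarrow> 'a \<Rightarrow> bool" and K :: "'b \<Rightarrow> 'a set" and V :: "'b set"
    and N :: "'b \<Rightarrow> 'b \<Rightarrow> bool" and D :: "'b \<Rightarrow> 'a set" and T :: "'b \<Rightarrow> 'b \<Rightarrow> ('a \<times> 'a) set"
    and k c :: nat
  assumes sym_E: "symp E" and sym_N: "symp N"
    and gates_subset: "\<And>b. D b \<subseteq> K b"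
    and block_walk: "\<And>b u v. b \<in> V \<Longrightarrow> u \<in> K b \<Longrightarrow> v \<in> K b \<Longrightarrow> cov_walk E (K b) u v c"
    and cross_block: "\<And>b b' v. N b b' \<Longrightarrow> v \<in> D b \<Longrightarrow>
          \<exists>w \<in> K b. \<exists>w' \<in> D b'. E w w' \<and> cov_walk E (K b) v w k"
    and enter_block: "\<And>b b'. N b b' \<Longrightarrow> \<exists>w \<in> K b. \<exists>w' \<in> D b'. E w w'"
    and port_adjacent: "\<And>a b v w. N a b \<Longrightarrow> (v, w) \<in> T b a \<Longrightarrow> \<exists>v' \<in> K a. \<exists>w' \<in> K a. E v' v \<and> E w w'"
    and tour_end: "\<And>a b. N a b \<Longrightarrow> \<exists>(v, w) \<in> T b a. cov_walk E (K b) v w k"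
    and tour_extend: "\<And>a b d v' w'. N a b \<Longrightarrow> N b d \<Longrightarrow> a \<noteq> d \<Longrightarrow> (v', w') \<in> T d b \<Longrightarrow>
          \<exists>(v, w) \<in> T b a. \<forall>Y n. cov_walk E Y v' w' n \<longrightarrow> cov_walk E (K b \<union> Y) v w (k + n)"
begin

lemma cross:
  assumes "successively N (b # ms @ [d])" "v \<in> D b"
  shows "\<exists>w \<in> D d. \<exists>u. E u w \<and> cov_walk E (\<Union>(K ` set (b # ms))) v u (k * length (b # ms))"
  using assms
proof (induction ms arbitrary: b v)
  case Nil
  then show ?case using cross_block[of b d v] by auto
next
  case (Cons a ms)
  then obtain w w' where w: "w' \<in> D a" "E w w'" "cov_walk E (K b) v w k"
    using cross_block[of b a v] by auto
  from Cons.IH[OF _ w(1)] Cons.prems obtain x u where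
    x: "x \<in> D d" "E u x" "cov_walk E (\<Union>(K ` set (a # ms))) w' u (k * length (a # ms))"
    by auto
  with cov_walk_append[OF w(3,2) x(3)] show ?case by auto
qed

text \<open>The walk has to begin and end inside the two outer blocks so that it can be joined to
  walks there; these two vertices are the extra \<open>2\<close>.\<close>

lemma traverse:
  assumes "successively N (a # ms @ [d])"
  shows "\<exists>u \<in> K a. \<exists>v \<in> K d. cov_walk E (\<Union>(K ` set ms)) u v (k * length ms + 2)"
proof (cases ms)
  case Nil
  with assms obtain u v where "u \<in> K a" "v \<in> D d" "E u v" using enter_block[of a d] by auto
  moreover from this have "cov_walk E {} u v 2" using cov_walk_path[of E "[u, v]" "{}" 2] by auto
  ultimately show ?thesis using gates_subset Nil by (auto simp: numeral_2_eq_2)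
next
  case (Cons b ms')
  with assms obtain u v where u: "u \<in> K a" "v \<in> D b" "E u v" using enter_block[of a b] by auto
  from cross[OF _ u(2), of ms' d] assms obtain w x where
    w: "w \<in> D d" "E x w" "cov_walk E (\<Union>(K ` set ms)) v x (k * length ms)"
    unfolding Cons by auto
  have "cov_walk E ({} \<union> \<Union>(K ` set ms) \<union> {}) u w (1 + k * length ms + 1)"
    by (rule cov_walk_append[OF cov_walk_append[OF cov_walk_refl u(3) w(3)] w(2) cov_walk_refl]) auto
  then show ?thesis using u(1) w(1) gates_subset by (auto simp: add.commute)
qed

text \<open>The induction builds the round trip from the far end: the ports of the next block are
  turned into ports of \<open>b\<close>. Distinctness ensures that the excursion leaves
  \<open>b\<close> towards a block other than \<open>a\<close>, as \<open>tour_extend\<close>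
  demands.\<close>

lemma tour:
  assumes "successively N (a # b # bs)" "distinct (a # b # bs)"
  shows "\<exists>(v, w) \<in> T b a. cov_walk E (\<Union>(K ` set (b # bs))) v w (k * length (b # bs))"
  using assms
proof (induction bs arbitrary: a b)
  case Nil
  then show ?case using tour_end[of a b] by auto
next
  case (Cons d bs)
  from Cons.IH[of b d] Cons.prems obtain v' w' where
    v': "(v', w') \<in> T d b" "cov_walk E (\<Union>(K ` set (d # bs))) v' w' (k * length (d # bs))"
    by auto
  with tour_extend[of a b d v' w'] Cons.prems obtain v w where
    "(v, w) \<in> T b a" "cov_walk E (K b \<union> \<Union>(K ` set (d # bs))) v w (k + k * length (d # bs))"
    by fastforce
  then show ?case by auto
qed

lemma excursion:
  assumes "successively N (a # bs)" "distinct (a # bs)" "a \<in> V" "K a \<noteq> {}"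
  shows "\<exists>u \<in> K a. \<exists>v \<in> K a. cov_walk E (\<Union>(K ` set bs)) u v (k * length bs + 2)"
proof (cases bs)
  case Nil
  obtain u where "u \<in> K a" using assms(4) by blast
  moreover have "cov_walk E {} u u 2" by (rule cov_walk_refl) auto
  ultimately show ?thesis using Nil by (auto simp: numeral_2_eq_2)
next
  case (Cons b bs')
  from tour[of a b bs'] assms obtain v w where
    v: "(v, w) \<in> T b a" "cov_walk E (\<Union>(K ` set bs)) v w (k * length bs)"
    unfolding Cons by auto
  from port_adjacent[OF _ v(1)] assms obtain v' w' where
    w: "v' \<in> K a" "w' \<in> K a" "E v' v" "E w w'" unfolding Cons by auto
  have "cov_walk E ({} \<union> \<Union>(K ` set bs) \<union> {}) v' w' (1 + k * length bs + 1)"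
    by (rule cov_walk_append[OF cov_walk_append[OF cov_walk_refl w(3) v(2)] w(4) cov_walk_refl]) auto
  then show ?thesis using w(1,2) by (auto simp: add.commute)
qed

lemma successively_rev_N: "successively N (rev bs) \<longleftrightarrow> successively N bs"
proof -
  have "(\<lambda>x y. N y x) = N" using sym_N by (auto simp: fun_eq_iff symp_def)
  then show ?thesis by (simp only: successively_rev)
qed

lemma chain_walk_ordered:
  assumes "successively N bs" "distinct bs" "set bs \<subseteq> V"
    and bs: "bs = ls @ a # ms @ d # rs" and "u \<in> K a" "v \<in> K d"
  shows "cov_walk E (\<Union>(K ` set bs)) u v (k * length bs + (4 * c + 6))"
proof -
  have ad: "a \<in> V" "d \<in> V" using assms(3) bs by auto
  have "successively N (a # rev ls)"
    using assms(1) successively_rev_N[of "ls @ [a]"] unfolding bs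
    by (auto simp: successively_append_iff)
  with assms obtain a1 a2 where
    a: "a1 \<in> K a" "a2 \<in> K a" "cov_walk E (\<Union>(K ` set ls)) a1 a2 (k * length ls + 2)"
    using excursion[of a "rev ls"] ad unfolding bs by auto
  have "successively N (a # ms @ [d])"
    using assms(1) successively_append_iff[of N ls "(a # ms @ [d]) @ rs"]
      successively_append_iff[of N "a # ms @ [d]" rs] by (simp add: bs)
  then obtain a3 d1 where
    m: "a3 \<in> K a" "d1 \<in> K d" "cov_walk E (\<Union>(K ` set ms)) a3 d1 (k * length ms + 2)"
    using traverse[of a ms d] by auto
  have "successively N (d # rs)"
    using assms(1) unfolding bs by (auto simp: successively_append_iff successively_Cons)
  with assms obtain d2 d3 where
    d: "d2 \<in> K d" "d3 \<in> K d" "cov_walk E (\<Union>(K ` set rs)) d2 d3 (k * length rs + 2)"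
    using excursion[of d "rs"] ad unfolding bs by auto
  \<comment> \<open>Four walks inside the end blocks (from \<open>u\<close> to the left excursion,
    on to the middle part, on to the right excursion, on to \<open>v\<close>) cost \<open>c\<close>
    each. The three pieces between them bring two extra vertices each, hence
    \<open>4 * c + 6\<close>.\<close>
  note W = cov_walk_join[OF cov_walk_join[OF cov_walk_join[OF cov_walk_join[OF cov_walk_join[OF cov_walk_join[OF
    block_walk[OF ad(1) assms(5) a(1)] a(3)] block_walk[OF ad(1) a(2) m(1)]] m(3)]
    block_walk[OF ad(2) m(2) d(1)]] d(3)] block_walk[OF ad(2) d(2) assms(6)]]
  show ?thesis
    by (rule cov_walk_mono[OF W]) (auto simp: bs algebra_simps)
qed

text \<open>With both end points in one block, three walks inside it and two excursions suffice. The
  resulting \<open>3 * c + 4\<close> is weakened to the bound of the other case.\<close>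

lemma chain_walk_same:
  assumes "successively N bs" "distinct bs" "set bs \<subseteq> V"
    and bs: "bs = ls @ a # rs" and "u \<in> K a" "v \<in> K a"
  shows "cov_walk E (\<Union>(K ` set bs)) u v (k * length bs + (4 * c + 6))"
proof -
  have ad: "a \<in> V" using assms(3) bs by auto
  have "successively N (a # rev ls)"
    using assms(1) successively_rev_N[of "ls @ [a]"] unfolding bs
    by (auto simp: successively_append_iff)
  with assms obtain a1 a2 where
    a: "a1 \<in> K a" "a2 \<in> K a" "cov_walk E (\<Union>(K ` set ls)) a1 a2 (k * length ls + 2)"
    using excursion[of a "rev ls"] ad unfolding bs by auto
  have "successively N (a # rs)"
    using assms(1) unfolding bs by (auto simp: successively_append_iff successively_Cons)
  with assms obtain d2 d3 where
    d: "d2 \<in> K a" "d3 \<in> K a" "cov_walk E (\<Union>(K ` set rs)) d2 d3 (k * length rs + 2)"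
    using excursion[of a "rs"] ad unfolding bs by auto
  note W = cov_walk_join[OF cov_walk_join[OF cov_walk_join[OF cov_walk_join[OF
    block_walk[OF ad assms(5) a(1)] a(3)] block_walk[OF ad a(2) d(1)]] d(3)] block_walk[OF ad d(2) assms(6)]]
  show ?thesis
    by (rule cov_walk_mono[OF W]) (auto simp: bs algebra_simps)
qed

theorem chain_walk:
  assumes "successively N bs" "distinct bs" "set bs \<subseteq> V"
    and "u \<in> \<Union>(K ` set bs)" "v \<in> \<Union>(K ` set bs)"
  shows "cov_walk E (\<Union>(K ` set bs)) u v (k * length bs + (4 * c + 6))"
proof -
  from assms obtain a d where ad: "a \<in> set bs" "d \<in> set bs" "u \<in> K a" "v \<in> K d" by auto
  from ad(1) obtain ls rs where bs: "bs = ls @ a # rs" by (meson split_list)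
  consider "d = a" | "d \<in> set rs" | "d \<in> set ls" using ad(2) bs by auto
  then show ?thesis
  proof cases
    case 1
    then show ?thesis using chain_walk_same[OF assms(1-3) bs] ad by auto
  next
    case 2
    then obtain ms rs' where "rs = ms @ d # rs'" by (meson split_list)
    then show ?thesis using chain_walk_ordered[OF assms(1-3), of ls a ms d rs'] ad bs by auto
  next
    case 3
    then obtain ls' ms where "ls = ls' @ d # ms" by (meson split_list)
    then show ?thesis
      using chain_walk_ordered[OF assms(1-3), of ls' d ms a rs v u] ad bs
      by (auto intro: cov_walk_sym[OF sym_E])
  qed
qed

end

section \<open>Grids\<close>

lemma cov_walk_segment:
  assumes "\<And>i. j \<le> i \<Longrightarrow> i < j' \<Longrightarrow> E (h i) (h (Suc i))" "j \<le> j'"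
  shows "cov_walk E (h ` {j..j'}) (h j) (h j') (Suc j' - j)"
proof -
  have "successively E (map h [j..<Suc j'])"
    using assms by (auto simp: successively_conv_nth simp del: upt_Suc)
  then show ?thesis
    using cov_walk_path[of E "map h [j..<Suc j']" "h ` {j..j'}"] assms
    by (auto simp: hd_map last_map atLeastLessThanSuc_atLeastAtMost simp del: upt_Suc)
qed

lemma cov_walk_segment_between:
  assumes "symp E" "\<And>i. Suc i < n \<Longrightarrow> E (h i) (h (Suc i))" "i < n" "j < n"
  shows "cov_walk E {} (h i) (h j) n"
proof (cases "i \<le> j")
  case True
  then show ?thesis using cov_walk_segment[of i j E h] assms by (auto elim!: cov_walk_mono)
next
  case False
  then show ?thesis using cov_walk_segment[of j i E h] assms
    by (auto elim!: cov_walk_mono intro: cov_walk_sym[OF assms(1)])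
qed

locale grid =
  fixes E :: "'a \<Rightarrow> 'a \<Rightarrow> bool" and g :: "nat \<Rightarrow> nat \<Rightarrow> 'a" and m n :: nat
  assumes sym_E: "symp E"
    and step_fst: "\<And>i j. Suc i < m \<Longrightarrow> j < n \<Longrightarrow> E (g i j) (g (Suc i) j)"
    and step_snd: "\<And>i j. i < m \<Longrightarrow> Suc j < n \<Longrightarrow> E (g i j) (g i (Suc j))"
begin

text \<open>The three terms \<open>n\<close> pay for going to row \<open>0\<close>, sweeping the
  column, and going from its top to \<open>v\<close>.\<close>

lemma column_walk:
  assumes "i < m" "u \<in> g i ` {..<n}" "v \<in> g i ` {..<n}"
  shows "cov_walk E (g i ` {..<n}) u v (3 * n)"
proof -
  from assms obtain a b where ab: "u = g i a" "a < n" "v = g i b" "b < n" by auto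
  have 0: "\<And>j. Suc j < n \<Longrightarrow> E (g i j) (g i (Suc j))" using assms(1) step_snd by auto
  have 1: "cov_walk E (g i ` {0..n - 1}) (g i 0) (g i (n - 1)) (Suc (n - 1) - 0)"
    using 0 by (intro cov_walk_segment) auto
  have "cov_walk E ({} \<union> g i ` {0..n - 1} \<union> {}) u v (n + (Suc (n - 1) - 0) + n)"
    unfolding ab using ab 0
    by (intro cov_walk_join[OF cov_walk_join[OF _ 1]] cov_walk_segment_between[OF sym_E]) auto
  then show ?thesis by (rule cov_walk_mono) (use ab in auto)
qed

text \<open>
  The blocks are the columns. An excursion goes out along the row \<open>0\<close> and comes back snaking through
  the remaining rows column by column.
\<close>

theorem narrow_grid_walk:
  assumes "2 \<le> n" "u \<in> case_prod g ` ({..<m} \<times> {..<n})" "v \<in> case_prod g ` ({..<m} \<times> {..<n})"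
  shows "cov_walk E (case_prod g ` ({..<m} \<times> {..<n})) u v (m * n + (12 * n + 6))"
proof -
  define N where "N i i' \<longleftrightarrow> i < m \<and> i' < m \<and> (i' = Suc i \<or> i = Suc i')" for i i'
  have hor: "E (g i j) (g i' j)" if "N i i'" "j < n" for i i' j
    using that step_fst[of i j] step_fst[of i' j] sym_E unfolding N_def by (auto dest: sympD)
  have up: "cov_walk E (g i ` {j..n - 1}) (g i j) (g i (n - 1)) (n - j)" if "i < m" "j < n" for i j
    using cov_walk_segment[of j "n - 1" E "g i"] step_snd[of i] that by (auto simp: Suc_diff_le)
  note down = cov_walk_sym[OF sym_E up]
  have Dz: "{0..n - Suc 0} = {..<n}" using assms(1) by auto
  \<comment> \<open>A column is swept from one end to the other, so its two ends are the gates. On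
    an excursion row \<open>0\<close> is reserved for the way out, and the way back leaves the rows
    \<open>1\<close> to \<open>n - 1\<close> alternately at their two ends; hence two possible pairs
    of ports. With \<open>c = 3 * n\<close> the error \<open>4 * c + 6\<close> becomes
    \<open>12 * n + 6\<close>.\<close>
  interpret block_graph E "\<lambda>i. g i ` {..<n}" "{..<m}" N "\<lambda>i. {g i 0, g i (n - 1)}"
    "\<lambda>i _. {(g i 0, g i 1), (g i 0, g i (n - 1))}" n "3 * n"
  proof
    show "symp E" by (rule sym_E)
    show "symp N" by (auto simp: symp_def N_def)
    show "{g i 0, g i (n - 1)} \<subseteq> g i ` {..<n}" for i using assms(1) by auto
    show "cov_walk E (g i ` {..<n}) u v (3 * n)"
      if "i \<in> {..<m}" "u \<in> g i ` {..<n}" "v \<in> g i ` {..<n}" for i u v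
      using column_walk that by auto
    show "\<exists>w\<in>g i ` {..<n}. \<exists>w'\<in>{g i' 0, g i' (n - 1)}. E w w' \<and> cov_walk E (g i ` {..<n}) v w n"
      if "N i i'" "v \<in> {g i 0, g i (n - 1)}" for i i' v
      using that up[of i 0] down[of i 0] hor[of i i' 0] hor[of i i' "n - 1"] assms(1)
      by (auto simp: N_def Dz)
    show "\<exists>w\<in>g i ` {..<n}. \<exists>w'\<in>{g i' 0, g i' (n - 1)}. E w w'" if "N i i'" for i i'
      using hor[OF that, of 0] assms(1) by auto
    show "\<exists>v'\<in>g a ` {..<n}. \<exists>w'\<in>g a ` {..<n}. E v' v \<and> E w w'"
      if N: "N a b" and "(v, w) \<in> {(g b 0, g b 1), (g b 0, g b (n - 1))}" for a b v w
    proof -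
      from that obtain j where "v = g b 0" "w = g b j" "j < n" using assms(1) by auto
      then show ?thesis using hor[OF N, of 0] hor[of b a j] N assms(1) by (auto simp: N_def)
    qed
    show "\<exists>(v, w)\<in>{(g b 0, g b 1), (g b 0, g b (n - 1))}. cov_walk E (g b ` {..<n}) v w n"
      if "N a b" for a b
      using up[of b 0] that assms(1) by (auto simp: N_def Dz)
    show "\<exists>(v, w)\<in>{(g b 0, g b 1), (g b 0, g b (n - 1))}.
            \<forall>Y l. cov_walk E Y v' w' l \<longrightarrow> cov_walk E (g b ` {..<n} \<union> Y) v w (n + l)"
      if N: "N a b" "N b d" and vw: "(v', w') \<in> {(g d 0, g d 1), (g d 0, g d (n - 1))}" for a b d v' w'
    proof -
      \<comment> \<open>Column \<open>b\<close> is left from row \<open>0\<close>. The return enters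
        its remaining rows at one end \<open>t\<close> and runs to the other end \<open>t'\<close>,
        so \<open>b\<close> costs \<open>n\<close> vertices in total.\<close>
      have *: "cov_walk E (g b ` {..<n} \<union> Y) (g b 0) (g b t') (n + l)"
        if Y: "cov_walk E Y v' w' l" and st: "cov_walk E (g b ` {1..n - 1}) (g b t) (g b t') (n - 1)"
          "v' = g d 0" "w' = g d t" "t < n" for Y l t t'
      proof -
        have "cov_walk E ({g b 0} \<union> Y \<union> g b ` {1..n - 1}) (g b 0) (g b t') (1 + l + (n - 1))"
          using Y st N assms(1) hor[of b d 0] hor[of b d t] sym_E
          by (intro cov_walk_append[OF cov_walk_append[OF cov_walk_refl _ Y] _ st(1)])
             (auto dest: sympD)
        then show ?thesis
        proof (rule cov_walk_mono)
          have "{..<n} = insert 0 {1..n - 1}" using assms(1) by auto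
          then show "g b ` {..<n} \<union> Y \<subseteq> {g b 0} \<union> Y \<union> g b ` {1..n - 1}" by auto
        qed (use assms(1) in auto)
      qed
      have b: "b < m" "1 < n" using N assms(1) by (auto simp: N_def)
      from vw consider "v' = g d 0" "w' = g d 1" | "v' = g d 0" "w' = g d (n - 1)" by auto
      then show ?thesis
      proof cases
        case 1
        then show ?thesis using *[OF _ up[OF b], of _ _] b by auto
      next
        case 2
        then show ?thesis using *[OF _ down[OF b], of _ _] b by auto
      qed
    qed
  qed
  have "successively N [0..<m]" by (auto simp: successively_conv_nth N_def)
  moreover have "\<Union> ((\<lambda>i. g i ` {..<n}) ` set [0..<m]) = case_prod g ` ({..<m} \<times> {..<n})" by auto
  ultimately show ?thesis using chain_walk[of "[0..<m]" u v] assms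
    by (auto simp: mult.commute lessThan_atLeast0)
qed

end

section \<open>Walks around a square with four corners\<close>

lemma cov_walk4:
  assumes "E a b" "E b c" "E c d"
  shows "cov_walk E {a, b, c, d} a d 4"
  using cov_walk_path[of E "[a, b, c, d]" "{a, b, c, d}" 4] assms by auto

text \<open>Going once around from \<open>v\<close> ends at one or the other neighbour of
  \<open>v\<close>, depending on the direction. The two neighbours are opposite corners, and the
  side \<open>{a, b}\<close> contains a corner of each diagonal.\<close>

lemma square_cross:
  assumes "symp E" "E a b" "E b c" "E c d" "E d a" "v \<in> {a, b, c, d}"
  shows "\<exists>w \<in> {a, b}. cov_walk E {a, b, c, d} v w 4"
proof -
  have "E b a" "E c b" "E d c" "E a d" using assms by (auto dest: sympD)
  then show ?thesis
    using assms(2-6) cov_walk4[of E a d c b] cov_walk4[of E b c d a] cov_walk4[of E c d a b]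
      cov_walk4[of E d c b a]
    by (auto simp: insert_commute)
qed

lemma square_walk:
  assumes "symp E" "E a b" "E b c" "E c d" "E d a" "u \<in> {a, b, c, d}" "v \<in> {a, b, c, d}"
  shows "cov_walk E {a, b, c, d} u v 10"
proof -
  have E: "E b a" "E c b" "E d c" "E a d" using assms by (auto dest: sympD)
  have *: "cov_walk E {} x y 3" if "x \<in> {a, b, c, d}" "y \<in> {a, b, c, d}" for x y
  proof -
    have "cov_walk E {} x x 3" by (rule cov_walk_refl) auto
    moreover have "cov_walk E {} x y 3" if "E x y"
      using cov_walk_path[of E "[x, y]" "{}" 3] that by auto
    moreover have "cov_walk E {} x y 3" if "E x z" "E z y" for z
      using cov_walk_path[of E "[x, z, y]" "{}" 3] that by auto
    ultimately show ?thesis using that assms(2-5) E by blast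
  qed
  \<comment> \<open>At most three vertices to reach \<open>a\<close>, four around to
    \<open>d\<close>, at most three to reach \<open>v\<close>.\<close>
  have "cov_walk E ({} \<union> {a, b, c, d} \<union> {}) u v (3 + 4 + 3)"
    using assms by (intro cov_walk_join[OF cov_walk_join[OF * cov_walk4] *]) auto
  then show ?thesis by simp
qed

text \<open>The path \<open>v\<close>, \<open>r\<close>, \<open>q\<close>, \<open>w\<close> runs
  along three sides of the square. The detour replaces the edge between \<open>s\<close> and
  \<open>t\<close>, and is reversed if the path passes that edge from \<open>t\<close> to
  \<open>s\<close>; the square itself still costs four vertices.\<close>

lemma square_detour:
  assumes "symp E" "E v r" "E r q" "E q w" and Y: "cov_walk E Y s' t' l" and "E s s'" "E t t'"
    and "(s, t) \<in> {(v, r), (r, v), (r, q), (q, r), (q, w), (w, q)}"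
  shows "cov_walk E ({v, r, q, w} \<union> Y) v w (4 + l)"
proof -
  note Y' = cov_walk_sym[OF assms(1) Y]
  have *: "cov_walk E ({v, r, q, w} \<union> Y) v w (4 + l)"
    if pY: "cov_walk E Y x y l" and xy: "E z x" "E y z'" and zz: "(z, z') \<in> {(v, r), (r, q), (q, w)}" for x y z z'
  proof -
    from pY obtain p where p: "p \<noteq> []" "hd p = x" "last p = y" "successively E p" "Y \<subseteq> set p"
      "length p \<le> l"
      unfolding cov_walk_def by blast
    consider "z = v" "z' = r" | "z = r" "z' = q" | "z = q" "z' = w" using zz by auto
    then show ?thesis
    proof cases
      case 1
      then show ?thesis using p xy assms(2-4) unfolding cov_walk_def
        by (intro exI[of _ "[v] @ p @ [r, q, w]"]) (auto simp: successively_append_iff successively_Cons)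
    next
      case 2
      then show ?thesis using p xy assms(2-4) unfolding cov_walk_def
        by (intro exI[of _ "[v, r] @ p @ [q, w]"]) (auto simp: successively_append_iff successively_Cons)
    next
      case 3
      then show ?thesis using p xy assms(2-4) unfolding cov_walk_def
        by (intro exI[of _ "[v, r, q] @ p @ [w]"]) (auto simp: successively_append_iff successively_Cons)
    qed
  qed
  have "E t' t" "E s' s" using assms by (auto dest: sympD)
  then show ?thesis using *[OF Y, of s t] *[OF Y', of t s] assms(6-8) by blast
qed

text \<open>Each row is run through against the direction of the previous one, so \<open>vs\<close>
  is generalised in the induction and \<open>Q\<close> must be symmetric. The head is part of the
  claim because the next row has to start next to the end of the current one. The lemma serves both
  to order the squares of a grid and to extend paths of coset representatives.\<close>

lemma snake:
  assumes "symp Q" "successively R us" "successively Q vs" "us \<noteq> []" "vs \<noteq> []"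
  shows "\<exists>zs. hd zs = (hd us, hd vs) \<and> set zs = set us \<times> set vs \<and> length zs = length us * length vs \<and>
    successively (\<lambda>(u, v) (u', v'). u = u' \<and> Q v v' \<or> R u u' \<and> v = v') zs"
  using assms(2-5)
proof (induction us arbitrary: vs)
  case (Cons u us)
  let ?P = "\<lambda>(u, v) (u', v'). u = u' \<and> Q v v' \<or> R u u' \<and> v = v'"
  have row: "successively ?P (map (Pair u) vs)" using Cons.prems by (auto simp: successively_map elim: successively_mono)
  show ?case
  proof (cases "us = []")
    case True
    then show ?thesis using row Cons.prems by (intro exI[of _ "map (Pair u) vs"]) (auto simp: hd_map)
  next
    case False
    have "successively Q (rev vs)"
      using Cons.prems(2) assms(1) by (auto elim!: successively_mono dest: sympD)
    with Cons.IH[of "rev vs"] Cons.prems False obtain zs where zs: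
      "hd zs = (hd us, last vs)" "set zs = set us \<times> set vs" "length zs = length us * length vs"
      "successively ?P zs"
      by (auto simp: successively_Cons hd_rev)
    have "zs \<noteq> []" using zs(3) False Cons.prems by auto
    then show ?thesis using row zs False Cons.prems
      by (intro exI[of _ "map (Pair u) vs @ zs"])
         (auto simp: hd_map hd_append last_map successively_append_iff successively_Cons)
  qed
qed simp

lemma double_ranges:
  fixes g :: "nat \<Rightarrow> nat \<Rightarrow> 'a"
  shows
  "case_prod g ` ({..<2 * m} \<times> {..<2 * n}) =
     (\<Union>(p, q) \<in> {..<m} \<times> {..<n}.
        {g (2 * p) (2 * q), g (2 * p + 1) (2 * q), g (2 * p + 1) (2 * q + 1), g (2 * p) (2 * q + 1)})"
  (is "?L = ?R")
proof
  show "?L \<subseteq> ?R"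
  proof
    fix x assume "x \<in> ?L"
    then obtain i j where x: "x = g i j" "i < 2 * m" "j < 2 * n" by auto
    have "i div 2 < m" "j div 2 < n" using x by auto
    moreover have "i = 2 * (i div 2) \<or> i = 2 * (i div 2) + 1" "j = 2 * (j div 2) \<or> j = 2 * (j div 2) + 1"
      by presburger+
    then have "x \<in> {g (2 * (i div 2)) (2 * (j div 2)), g (2 * (i div 2) + 1) (2 * (j div 2)),
        g (2 * (i div 2) + 1) (2 * (j div 2) + 1), g (2 * (i div 2)) (2 * (j div 2) + 1)}"
      unfolding x(1) by (metis insert_iff)
    ultimately show "x \<in> ?R" by blast
  qed
  show "?R \<subseteq> ?L" by (auto simp: image_iff intro!: bexI[of _ "(_, _)"])
qed

text \<open>
  The blocks are the \<open>2 \<times> 2\<close> squares, ordered by a snake. The way around a square that starts and ends at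
  its side facing \<open>a\<close> runs along its three other sides, hence through the side facing the next square.
\<close>

theorem even_grid_walk:
  assumes "grid E g (2 * m) (2 * n)"
    and "u \<in> case_prod g ` ({..<2 * m} \<times> {..<2 * n})" "v \<in> case_prod g ` ({..<2 * m} \<times> {..<2 * n})"
  shows "cov_walk E (case_prod g ` ({..<2 * m} \<times> {..<2 * n})) u v (2 * m * (2 * n) + 46)"
proof -
  interpret grid E g "2 * m" "2 * n" by fact
  define V where "V = {..<m} \<times> {..<n}"
  define bl br tr tl where
    "bl = (\<lambda>(p, q). g (2 * p) (2 * q))" and "br = (\<lambda>(p, q). g (2 * p + 1) (2 * q))" and
    "tr = (\<lambda>(p, q). g (2 * p + 1) (2 * q + 1))" and "tl = (\<lambda>(p, q). g (2 * p) (2 * q + 1))"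
  define K where "K b = {bl b, br b, tr b, tl b}" for b
  define N where "N b b' \<longleftrightarrow> b \<in> V \<and> b' \<in> V \<and>
    (fst b = fst b' \<and> (snd b' = Suc (snd b) \<or> snd b = Suc (snd b')) \<or>
     (fst b' = Suc (fst b) \<or> fst b = Suc (fst b')) \<and> snd b = snd b')" for b b' :: "nat \<times> nat"
  \<comment> \<open>The corners of \<open>b\<close> on the side towards \<open>a\<close>, listed by
    increasing coordinate. Both squares use the same order, so corresponding entries of
    \<open>face b a\<close> and \<open>face a b\<close> are adjacent.\<close>
  define face where "face b a =
    (if fst a < fst b then (bl b, tl b) else if fst b < fst a then (br b, tr b)
     else if snd a < snd b then (bl b, br b) else (tl b, tr b))" for a b :: "nat \<times> nat"
  have sq: "E (bl b) (br b)" "E (br b) (tr b)" "E (tr b) (tl b)" "E (tl b) (bl b)"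
    "E (br b) (bl b)" "E (tr b) (br b)" "E (tl b) (tr b)" "E (bl b) (tl b)" if "b \<in> V" for b
    using that step_fst[of "2 * fst b" "2 * snd b"] step_fst[of "2 * fst b" "2 * snd b + 1"]
      step_snd[of "2 * fst b" "2 * snd b"] step_snd[of "2 * fst b + 1" "2 * snd b"] sym_E
    by (auto simp: V_def bl_def br_def tr_def tl_def split_beta dest: sympD)
  have sym_N: "symp N" by (auto simp: symp_def N_def)
  have link: "E (fst (face b a)) (fst (face a b)) \<and> E (snd (face b a)) (snd (face a b))" if "N b a" for b a
  proof -
    have *: "E (fst (face b a)) (fst (face a b)) \<and> E (snd (face b a)) (snd (face a b))"
      if "N b a" "fst a = Suc (fst b) \<and> snd a = snd b \<or> fst a = fst b \<and> snd a = Suc (snd b)" for a b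
      using that step_fst[of "2 * fst b + 1" "2 * snd b"] step_fst[of "2 * fst b + 1" "2 * snd b + 1"]
        step_snd[of "2 * fst b" "2 * snd b + 1"] step_snd[of "2 * fst b + 1" "2 * snd b + 1"]
      by (auto simp: N_def face_def V_def bl_def br_def tr_def tl_def split_beta)
    show ?thesis using *[of b a] *[of a b] that sym_N sym_E unfolding N_def
      by (metis sympD)
  qed
  have face_K: "fst (face b a) \<in> K b" "snd (face b a) \<in> K b" for b a by (auto simp: face_def K_def)
  \<comment> \<open>Every corner is a gate, since by \<open>square_cross\<close> a square can be
    swept from any corner so as to end on the prescribed side. The values \<open>k = 4\<close> and
    \<open>c = 10\<close> yield the error \<open>4 * 10 + 6 = 46\<close>.\<close>
  interpret block_graph E K V N K "\<lambda>b a. {face b a}" 4 10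
  proof
    show "cov_walk E (K b) u v 10" if "b \<in> V" "u \<in> K b" "v \<in> K b" for b u v
      using square_walk[OF sym_E sq(1-4)] that by (simp add: K_def)
    show "\<exists>w\<in>K b. \<exists>w'\<in>K b'. E w w' \<and> cov_walk E (K b) v w 4" if N: "N b b'" and v: "v \<in> K b" for b b' v
    proof -
      have b: "b \<in> V" using N by (simp add: N_def)
      have "\<exists>w \<in> {fst (face b b'), snd (face b b')}. cov_walk E (K b) v w 4"
        using square_cross[OF sym_E sq(1-4)[OF b], of v] square_cross[OF sym_E sq(2,3,4,1)[OF b], of v]
          square_cross[OF sym_E sq(3,4,1,2)[OF b], of v] square_cross[OF sym_E sq(4,1,2,3)[OF b], of v] v
        by (auto simp: K_def face_def insert_commute)
      then show ?thesis using link[OF N] face_K by blast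
    qed
    show "\<exists>w\<in>K b. \<exists>w'\<in>K b'. E w w'" if "N b b'" for b b' using link[OF that] face_K by blast
    show "\<exists>v'\<in>K a. \<exists>w'\<in>K a. E v' v \<and> E w w'" if "N a b" "(v, w) \<in> {face b a}" for a b v w
      using link[OF that(1)] that(2) face_K sym_E by (metis fst_conv singletonD snd_conv sympD)
    show "\<exists>(v, w)\<in>{face b a}. cov_walk E (K b) v w 4" if "N a b" for a b
    proof -
      have "b \<in> V" using that by (simp add: N_def)
      note s = sq[OF this]
      show ?thesis
        using cov_walk4[of E "bl b" "br b" "tr b" "tl b"] cov_walk4[of E "br b" "bl b" "tl b" "tr b"]
          cov_walk4[of E "bl b" "tl b" "tr b" "br b"] cov_walk4[of E "tl b" "bl b" "br b" "tr b"] s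
        by (auto simp: K_def face_def insert_commute)
    qed
    show "\<exists>(v, w)\<in>{face b a}. \<forall>Y l. cov_walk E Y v' w' l \<longrightarrow> cov_walk E (K b \<union> Y) v w (4 + l)"
      if N: "N a b" "N b d" "a \<noteq> d" "(v', w') \<in> {face d b}" for a b d v' w'
    proof -
      have b: "b \<in> V" using N by (simp add: N_def)
      note s = sq[OF b]
      have l: "E (fst (face b d)) v'" "E (snd (face b d)) w'" using link[OF N(2)] N(4) by (metis fst_conv snd_conv singletonD)+
      have K: "K b = {bl b, br b, tr b, tl b}" "K b = {br b, bl b, tl b, tr b}"
        "K b = {bl b, tl b, tr b, br b}" "K b = {tl b, bl b, br b, tr b}"
        unfolding K_def by blast+
      have dir: "fst a < fst b \<or> fst b < fst a \<or> fst a = fst b \<and> snd a < snd b \<or> fst a = fst b \<and> snd b < snd a"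
        using N(1) by (auto simp: N_def)
      have "cov_walk E (K b \<union> Y) (fst (face b a)) (snd (face b a)) (4 + l)" if Y: "cov_walk E Y v' w' l" for Y l
        using dir
      proof (elim disjE conjE)
        assume a: "fst a < fst b"
        then have "\<not> fst d < fst b" using N(1-3) by (auto simp: N_def prod_eq_iff)
        then have "(fst (face b d), snd (face b d)) \<in> {(br b, tr b), (bl b, br b), (tl b, tr b)}"
          by (simp add: face_def)
        moreover have "face b a = (bl b, tl b)" using a by (simp add: face_def)
        ultimately show ?thesis unfolding K(1) using square_detour[OF sym_E s(1,2,3) Y l] by auto
      next
        assume a: "fst b < fst a"
        then have "\<not> fst b < fst d" using N(1-3) by (auto simp: N_def prod_eq_iff)
        then have "(fst (face b d), snd (face b d)) \<in> {(bl b, tl b), (bl b, br b), (tl b, tr b)}"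
          by (simp add: face_def)
        moreover have "face b a = (br b, tr b)" using a by (simp add: face_def)
        ultimately show ?thesis unfolding K(2) using square_detour[OF sym_E s(5,8,7) Y l] by auto
      next
        assume a: "fst a = fst b" "snd a < snd b"
        then have "fst d < fst b \<or> fst b < fst d \<or> \<not> snd d < snd b"
          using N(1-3) by (auto simp: N_def prod_eq_iff)
        then have "(fst (face b d), snd (face b d)) \<in> {(bl b, tl b), (br b, tr b), (tl b, tr b)}"
          by (auto simp add: face_def)
        moreover have "face b a = (bl b, br b)" using a by (simp add: face_def)
        ultimately show ?thesis unfolding K(3) using square_detour[OF sym_E s(8,7,6) Y l] by auto
      next
        assume a: "fst a = fst b" "snd b < snd a"
        then have "fst d < fst b \<or> fst b < fst d \<or> snd d < snd b"
          using N(1-3) by (auto simp: N_def prod_eq_iff)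
        then have "(fst (face b d), snd (face b d)) \<in> {(bl b, tl b), (br b, tr b), (bl b, br b)}"
          by (auto simp add: face_def)
        moreover have "face b a = (tl b, tr b)" using a by (simp add: face_def)
        ultimately show ?thesis unfolding K(4) using square_detour[OF sym_E s(4,1,2) Y l] by auto
      qed
      then show ?thesis by (auto simp: split_beta)
    qed
  qed (use sym_E sym_N in auto)
  have mn: "m \<noteq> 0" "n \<noteq> 0" using assms(2) by auto
  let ?R = "\<lambda>i j. (j = Suc i \<or> i = Suc j)"
  have "successively ?R [0..<l]" for l by (auto simp: successively_conv_nth)
  then obtain bs where bs: "set bs = V" "length bs = m * n"
    "successively (\<lambda>(u, v) (u', v'). u = u' \<and> ?R v v' \<or> ?R u u' \<and> v = v') bs"
    using snake[of ?R ?R "[0..<m]" "[0..<n]"] mn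
    by (auto simp: symp_def V_def lessThan_atLeast0)
  have "successively N bs"
    using bs(3) by (rule successively_mono) (auto simp: N_def bs(1))
  moreover have "distinct bs" using bs by (intro card_distinct) (simp add: V_def)
  moreover have "\<Union> (K ` set bs) = case_prod g ` ({..<2 * m} \<times> {..<2 * n})"
    unfolding double_ranges bs(1) V_def K_def bl_def br_def tr_def tl_def by auto
  ultimately show ?thesis using chain_walk[of bs u v] assms bs by (simp add: mult.assoc mult.left_commute)
qed

section \<open>Paths of coset representatives\<close>

text \<open>Letting \<open>s\<close> act on either end point gives symmetry without mentioning
  inverses. If \<open>S\<close> contains the identity there are loops; they are removed only when
  walks are transferred to the Cayley graph.\<close>

definition cay_adj :: "('a, 'm) monoid_scheme \<Rightarrow> 'a set \<Rightarrow> 'a \<Rightarrow> 'a \<Rightarrow> bool" where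
  "cay_adj G S x y \<longleftrightarrow> x \<in> carrier G \<and> y \<in> carrier G \<and> (\<exists>s \<in> S. y = x \<otimes>\<^bsub>G\<^esub> s \<or> x = y \<otimes>\<^bsub>G\<^esub> s)"

text \<open>
  \<open>w\<close> is a path whose vertices represent different cosets of \<open>N\<close>, among them those of all elements of \<open>A\<close>.
\<close>

definition transversal_path ::
    "('a, 'm) monoid_scheme \<Rightarrow> 'a set \<Rightarrow> 'a set \<Rightarrow> 'a set \<Rightarrow> 'a set \<Rightarrow> 'a list \<Rightarrow> bool" where
  "transversal_path G S N H A w \<longleftrightarrow>
     w \<noteq> [] \<and> set w \<subseteq> H \<and> distinct w \<and> successively (cay_adj G S) w \<and>
     (\<forall>x \<in> set w. \<forall>y \<in> set w. x \<otimes>\<^bsub>G\<^esub> inv\<^bsub>G\<^esub> y \<in> N \<longrightarrow> x = y) \<and>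
     (\<forall>x \<in> A. \<exists>y \<in> set w. x \<otimes>\<^bsub>G\<^esub> inv\<^bsub>G\<^esub> y \<in> N)"

lemma symp_cay_adj: "symp (cay_adj G S)"
  by (auto simp: symp_def cay_adj_def)

lemma transversal_path_mono: "transversal_path G S N H A w \<Longrightarrow> A' \<subseteq> A \<Longrightarrow> transversal_path G S N H A' w"
  by (auto simp: transversal_path_def)

context comm_group
begin

lemma generate_insert:
  assumes "T \<subseteq> carrier G" "t \<in> carrier G" "x \<in> generate G (insert t T)"
  obtains k :: int and h where "h \<in> generate G T" "x = t [^] k \<otimes> h"
proof -
  have "\<exists>k :: int. \<exists>h \<in> generate G T. x = t [^] k \<otimes> h"
    using assms(3)
  proof (induction rule: generate.induct)
    case one
    show ?case by (intro exI[of _ 0] bexI[of _ \<one>]) (auto intro: generate.one)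
  next
    case (incl h)
    show ?case
    proof (cases "h = t")
      case True
      then show ?thesis using assms by (intro exI[of _ 1] bexI[of _ \<one>]) (auto intro: generate.one)
    next
      case False
      then show ?thesis using assms incl
        by (intro exI[of _ 0] bexI[of _ h]) (auto intro: generate.incl)
    qed
  next
    case (inv h)
    show ?case
    proof (cases "h = t")
      case True
      then show ?thesis using assms
        by (intro exI[of _ "-1"] bexI[of _ \<one>]) (auto intro: generate.one simp: int_pow_neg)
    next
      case False
      then show ?thesis using assms inv
        by (intro exI[of _ 0] bexI[of _ "inv h"]) (auto intro: generate.inv)
    qed
  next
    case (eng x y)
    then obtain k l :: int and h h' where
      *: "h \<in> generate G T" "x = t [^] k \<otimes> h" "h' \<in> generate G T" "y = t [^] l \<otimes> h'" by blast
    have "h \<in> carrier G" "h' \<in> carrier G" using * generate_in_carrier[OF assms(1)] by auto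
    then have "x \<otimes> y = t [^] (k + l) \<otimes> (h \<otimes> h')"
      using assms(2) * by (simp add: int_pow_mult m_ac)
    then show ?case using generate.eng[OF *(1,3)] by blast
  qed
  then show thesis using that by blast
qed

lemma int_pow_in_generate_insert:
  assumes "T \<subseteq> carrier G" "t \<in> carrier G"
  shows "t [^] (k :: int) \<in> generate G (insert t T)"
  using subgroup_int_pow_closed[OF generate_is_subgroup generate.incl] assms by auto

text \<open>
  The new path snakes through the products \<open>t [^] i \<otimes> x\<close> with \<open>i\<close> in \<open>us\<close> and \<open>x\<close> in \<open>w\<close>.
\<close>

lemma transversal_path_extend:
  fixes us :: "int list"
  assumes T: "T \<subseteq> carrier G" and S: "S \<subseteq> carrier G" and t: "t \<in> S"
    and N: "subgroup N G" "N \<subseteq> generate G T"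
    and w: "transversal_path G S N (generate G T) A w"
    and us: "us \<noteq> []" "distinct us" "successively (\<lambda>i j. \<bar>i - j\<bar> = 1) us"
    and us_inj: "\<And>i j. i \<in> set us \<Longrightarrow> j \<in> set us \<Longrightarrow> t [^] (i - j) \<in> generate G T \<Longrightarrow> i = j"
    and A': "\<And>x. x \<in> A' \<Longrightarrow> x \<in> carrier G \<and> (\<exists>i \<in> set us. inv (t [^] i) \<otimes> x \<in> A)"
  shows "\<exists>w'. transversal_path G S N (generate G (insert t T)) A' w' \<and> length w' = length us * length w"
proof -
  have tG: "t \<in> carrier G" using S t by auto
  have wG: "x \<in> carrier G" if "x \<in> set w" for x
    using that w generate_incl[OF T] by (auto simp: transversal_path_def)
  obtain zs where zs: "set zs = set us \<times> set w" "length zs = length us * length w"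
    "successively (\<lambda>(u, v) (u', v'). u = u' \<and> cay_adj G S v v' \<or> \<bar>u - u'\<bar> = 1 \<and> v = v') zs"
    using snake[OF symp_cay_adj us(3), of G S w] us(1) w by (auto simp: transversal_path_def)
  define f where "f = (\<lambda>(i :: int, x). t [^] i \<otimes> x)"
  \<comment> \<open>Modulo \<open>generate G T\<close>, which contains \<open>N\<close> and all of
    \<open>w\<close>, only the power of \<open>t\<close> survives, and \<open>us_inj\<close> forces
    equal exponents. These cancel, and the remaining quotient is handled by the property of
    \<open>w\<close>.\<close>
  have modN: "p = q" if p: "p \<in> set zs" and q: "q \<in> set zs" and pq: "f p \<otimes> inv (f q) \<in> N" for p q
  proof -
    obtain i x j y where [simp]: "p = (i, x)" "q = (j, y)" by fastforce
    have ij: "i \<in> set us" "j \<in> set us" and xy: "x \<in> set w" "y \<in> set w" using p q zs(1) by auto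
    have eq: "f p \<otimes> inv (f q) = t [^] (i - j) \<otimes> (x \<otimes> inv y)"
      using tG wG xy by (simp add: f_def int_pow_diff inv_mult_group m_ac)
    have xyH: "x \<otimes> inv y \<in> generate G T"
      using xy w generate_m_inv_closed[OF T] by (auto simp: transversal_path_def intro: generate.eng)
    have "t [^] (i - j) = (f p \<otimes> inv (f q)) \<otimes> inv (x \<otimes> inv y)"
      unfolding eq using tG wG xy by (simp add: m_assoc)
    moreover have "\<dots> \<in> generate G T"
      using pq N(2) xyH generate_m_inv_closed[OF T xyH] by (auto intro: generate.eng)
    ultimately have "i = j" using us_inj ij by simp
    then have "x \<otimes> inv y \<in> N" using pq unfolding eq using tG wG xy by simp
    then show ?thesis using w xy \<open>i = j\<close> by (auto simp: transversal_path_def)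
  qed
  have fG: "f p \<in> carrier G" if "p \<in> set zs" for p
    using that zs(1) wG tG by (auto simp: f_def)
  have inj: "inj_on f (set zs)"
  proof (rule inj_onI)
    fix p q assume pq: "p \<in> set zs" "q \<in> set zs" "f p = f q"
    then have "f p \<otimes> inv (f q) \<in> N" using fG subgroup.one_closed[OF N(1)] by simp
    then show "p = q" using modN pq by blast
  qed
  have "distinct w" using w by (simp add: transversal_path_def)
  then have "distinct zs" using zs us(2) by (intro card_distinct) (simp add: distinct_card card_cartesian_product)
  have sub: "generate G T \<subseteq> generate G (insert t T)" by (rule mono_generate) auto
  have adj: "cay_adj G S (f p) (f q)"
    if "p \<in> set zs" "q \<in> set zs" and
      pq: "(\<lambda>(u, v) (u', v'). u = u' \<and> cay_adj G S v v' \<or> \<bar>u - u'\<bar> = 1 \<and> v = v') p q" for p q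
  proof -
    obtain i x j y where [simp]: "p = (i, x)" "q = (j, y)" by fastforce
    have xy: "x \<in> carrier G" "y \<in> carrier G" using that(1,2) zs(1) wG by auto
    have *: "cay_adj G S (t [^] k \<otimes> z) (t [^] (k + 1) \<otimes> z)" if "z \<in> carrier G" for k :: int and z
      using that tG t unfolding cay_adj_def by (auto simp: int_pow_mult m_ac intro!: bexI[of _ t])
    show ?thesis
    proof (cases "i = j \<and> cay_adj G S x y")
      case True
      then show ?thesis using tG xy S unfolding cay_adj_def f_def
        by (auto simp: m_assoc subset_iff)
    next
      case False
      then have "x = y" "j = i + 1 \<or> i = j + 1" using pq by auto
      then show ?thesis using *[of x i] *[of x j] xy symp_cay_adj[of G S] by (auto simp: f_def dest: sympD)
    qed
  qed
  have "transversal_path G S N (generate G (insert t T)) A' (map f zs)"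
    unfolding transversal_path_def
  proof (intro conjI ballI impI)
    show "map f zs \<noteq> []" using zs(2) us(1) w by (auto simp: transversal_path_def)
    show "set (map f zs) \<subseteq> generate G (insert t T)"
      using w zs(1) sub int_pow_in_generate_insert[OF T tG]
      by (auto simp: f_def transversal_path_def intro!: generate.eng)
    show "distinct (map f zs)" using inj \<open>distinct zs\<close> by (simp add: distinct_map)
    show "successively (cay_adj G S) (map f zs)"
      unfolding successively_map using zs(3) by (rule successively_mono) (use adj in auto)
    show "x = y" if "x \<in> set (map f zs)" "y \<in> set (map f zs)" "x \<otimes> inv y \<in> N" for x y
      using that modN by auto
    show "\<exists>y \<in> set (map f zs). x \<otimes> inv y \<in> N" if x: "x \<in> A'" for x
    proof -
      from A'[OF x] obtain i where i: "x \<in> carrier G" "i \<in> set us" "inv (t [^] i) \<otimes> x \<in> A" by blast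
      then obtain y where y: "y \<in> set w" "(inv (t [^] i) \<otimes> x) \<otimes> inv y \<in> N"
        using w by (auto simp: transversal_path_def)
      have "x \<otimes> inv (f (i, y)) = (inv (t [^] i) \<otimes> x) \<otimes> inv y"
        using tG wG[OF y(1)] i by (simp add: f_def inv_mult_group m_ac)
      moreover have "f (i, y) \<in> set (map f zs)" using y(1) i(2) zs(1) by auto
      ultimately show ?thesis using y(2) by metis
    qed
  qed
  then show ?thesis using zs(2) by (intro exI[of _ "map f zs"]) simp
qed

text \<open>The exponents run from \<open>0\<close> to \<open>m - 1\<close>, where \<open>m\<close>
  is the order of \<open>t\<close> modulo \<open>generate G T\<close>. As \<open>I\<close> and
  \<open>m\<close> depend on neither \<open>A\<close> nor \<open>w\<close>, the lemma serves both a
  path through all cosets and paths for finite \<open>A\<close>; finiteness of \<open>I\<close>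
  keeps the required set finite in the latter case, and the factor \<open>m\<close> keeps an even
  length even.\<close>

lemma transversal_path_extend_torsion:
  assumes T: "T \<subseteq> carrier G" and S: "S \<subseteq> carrier G" and t: "t \<in> S"
    and N: "subgroup N G" "N \<subseteq> generate G T"
    and k: "t [^] (k :: nat) \<in> generate G T" "k > 0"
  shows "\<exists>I m. finite I \<and> (\<forall>A w. A \<subseteq> generate G (insert t T) \<longrightarrow>
      transversal_path G S N (generate G T)
        ((\<lambda>(i :: int, x). inv (t [^] i) \<otimes> x) ` (I \<times> A) \<inter> generate G T) w \<longrightarrow>
      (\<exists>w'. transversal_path G S N (generate G (insert t T)) A w' \<and> length w' = m * length w))"
proof -
  define m where "m = (LEAST m :: nat. 0 < m \<and> t [^] m \<in> generate G T)"
  have m: "0 < m" "t [^] m \<in> generate G T" using LeastI[of "\<lambda>m. 0 < m \<and> t [^] m \<in> generate G T" k] k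
    unfolding m_def by auto
  have least: "m \<le> j" if "0 < j" "t [^] j \<in> generate G T" for j :: nat
    unfolding m_def using that by (intro Least_le) auto
  have tG: "t \<in> carrier G" using S t by auto
  note H = generate_is_subgroup[OF T]
  define us where "us = map int [0..<m]"
  have us: "us \<noteq> []" "distinct us" "successively (\<lambda>i j. \<bar>i - j\<bar> = 1) us" "length us = m" "set us = {0..<int m}"
    using m(1) by (auto simp: us_def distinct_map successively_conv_nth image_int_atLeastLessThan)
  have inj: "i = j" if ij: "i \<in> set us" "j \<in> set us" "t [^] (i - j) \<in> generate G T" for i j
  proof (rule ccontr)
    assume "i \<noteq> j"
    have "t [^] (- (i - j)) \<in> generate G T"
      using subgroup.m_inv_closed[OF H ij(3)] tG by (simp only: int_pow_neg)
    then have "t [^] \<bar>i - j\<bar> \<in> generate G T" using ij(3) by (auto simp: abs_if)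
    then have "t [^] nat \<bar>i - j\<bar> \<in> generate G T" by (metis abs_ge_zero int_nat_eq int_pow_int)
    then have "m \<le> nat \<bar>i - j\<bar>" using \<open>i \<noteq> j\<close> by (intro least) auto
    then show False using ij(1,2) us(5) by auto
  qed
  have cover: "x \<in> carrier G \<and> (\<exists>i \<in> set us. inv (t [^] i) \<otimes> x \<in> generate G T)"
    if x: "x \<in> generate G (insert t T)" for x
  proof -
    obtain j :: int and h where h: "h \<in> generate G T" "x = t [^] j \<otimes> h" using generate_insert[OF T tG x] by blast
    have hG: "h \<in> carrier G" using h generate_in_carrier[OF T] by auto
    define i where "i = j mod int m"
    have "i \<in> set us" using m(1) by (simp add: i_def us(5))
    have "inv (t [^] i) \<otimes> x = t [^] (j - i) \<otimes> h"
      unfolding h(2) using tG hG by (simp add: int_pow_diff m_ac)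
    also have "j - i = int m * (j div int m)" by (simp add: i_def minus_mod_eq_mult_div)
    also have "t [^] (int m * (j div int m)) = (t [^] m) [^] (j div int m)"
      using tG by (simp flip: int_pow_pow add: int_pow_int)
    also have "(t [^] m) [^] (j div int m) \<otimes> h \<in> generate G T"
      using subgroup_int_pow_closed[OF H m(2)] h(1) by (auto intro: generate.eng)
    finally show ?thesis using \<open>i \<in> set us\<close> h(2) hG tG by auto
  qed
  show ?thesis
  proof (rule exI[of _ "set us"], rule exI[of _ m], intro conjI allI impI)
    show "finite (set us)" by simp
    fix A w
    let ?A' = "(\<lambda>(i, x). inv (t [^] i) \<otimes> x) ` (set us \<times> A) \<inter> generate G T"
    assume A: "A \<subseteq> generate G (insert t T)" and w: "transversal_path G S N (generate G T) ?A' w"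
    have "x \<in> carrier G \<and> (\<exists>i \<in> set us. inv (t [^] i) \<otimes> x \<in> ?A')" if "x \<in> A" for x
      using cover[of x] A that by force
    from transversal_path_extend[OF T S t N w us(1-3) inj this] us(4)
    show "\<exists>w'. transversal_path G S N (generate G (insert t T)) A w' \<and> length w' = m * length w"
      by simp
  qed
qed

text \<open>Different powers of \<open>t\<close> lie in different cosets of
  \<open>generate G T\<close>, so any interval of exponents is admissible, and one of size
  \<open>2 * n\<close> makes the length even whatever the length of \<open>w\<close>. The set
  \<open>A'\<close> consists of what is left of \<open>A\<close> after splitting off powers of
  \<open>t\<close>; it is fixed before \<open>w\<close> because \<open>w\<close> has to be built for
  it.\<close>

lemma transversal_path_extend_free:
  assumes T: "T \<subseteq> carrier G" and S: "S \<subseteq> carrier G" and t: "t \<in> S"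
    and N: "subgroup N G" "N \<subseteq> generate G T"
    and free: "\<And>k :: nat. k > 0 \<Longrightarrow> t [^] k \<notin> generate G T"
    and A: "finite A" "A \<subseteq> generate G (insert t T)"
  shows "\<exists>A'. finite A' \<and> A' \<subseteq> generate G T \<and>
      (\<forall>w. transversal_path G S N (generate G T) A' w \<longrightarrow>
      (\<exists>w'. transversal_path G S N (generate G (insert t T)) A w' \<and> even (length w')))"
proof -
  have tG: "t \<in> carrier G" using S t by auto
  note H = generate_is_subgroup[OF T]
  have "\<exists>k :: int. inv (t [^] k) \<otimes> x \<in> generate G T" if "x \<in> A" for x
  proof -
    obtain k :: int and h where h: "h \<in> generate G T" "x = t [^] k \<otimes> h"
      using generate_insert[OF T tG] A(2) \<open>x \<in> A\<close> by blast
    have "h \<in> carrier G" using h generate_in_carrier[OF T] by auto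
    then have "inv (t [^] k) \<otimes> x = h" using h(2) tG by (simp flip: m_assoc)
    then show ?thesis using h by metis
  qed
  then obtain \<kappa> :: "'a \<Rightarrow> int" where \<kappa>: "\<And>x. x \<in> A \<Longrightarrow> inv (t [^] \<kappa> x) \<otimes> x \<in> generate G T" by metis
  \<comment> \<open>The sum is a crude substitute for a maximum; \<open>Suc\<close> makes the bound
    strict and keeps \<open>n\<close> positive when \<open>A\<close> is empty.\<close>
  define n where "n = Suc (\<Sum>x\<in>A. nat \<bar>\<kappa> x\<bar>)"
  have n: "\<bar>\<kappa> x\<bar> < int n" if "x \<in> A" for x
    using member_le_sum[of x A "\<lambda>x. nat \<bar>\<kappa> x\<bar>"] A(1) that unfolding n_def by linarith
  have "n > 0" by (simp add: n_def)
  define us where "us = map (\<lambda>i. int i - int n) [0..<2 * n]"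
  have us: "us \<noteq> []" "distinct us" "successively (\<lambda>i j. \<bar>i - j\<bar> = 1) us" "length us = 2 * n"
    using \<open>n > 0\<close> by (auto simp: us_def distinct_map inj_on_def successively_conv_nth)
  have us_mem: "i \<in> set us" if "\<bar>i\<bar> < int n" for i
    using that by (auto simp: us_def image_iff intro!: bexI[of _ "nat (i + int n)"])
  have inj: "i = j" if ij: "t [^] (i - j) \<in> generate G T" for i j :: int
  proof (rule ccontr)
    assume "i \<noteq> j"
    have "t [^] (- (i - j)) \<in> generate G T"
      using subgroup.m_inv_closed[OF H ij] tG by (simp only: int_pow_neg)
    then have "t [^] \<bar>i - j\<bar> \<in> generate G T" using ij by (auto simp: abs_if)
    then have "t [^] nat \<bar>i - j\<bar> \<in> generate G T" by (metis abs_ge_zero int_nat_eq int_pow_int)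
    then show False using free[of "nat \<bar>i - j\<bar>"] \<open>i \<noteq> j\<close> by auto
  qed
  show ?thesis
  proof (rule exI, intro conjI allI impI)
    let ?A' = "(\<lambda>x. inv (t [^] \<kappa> x) \<otimes> x) ` A"
    show "finite ?A'" using A by auto
    show "?A' \<subseteq> generate G T" using \<kappa> by auto
    fix w assume w: "transversal_path G S N (generate G T) ?A' w"
    have "x \<in> carrier G \<and> (\<exists>i \<in> set us. inv (t [^] i) \<otimes> x \<in> ?A')" if "x \<in> A" for x
      using that A(2) generate_in_carrier[of "insert t T" x] T tG us_mem[OF n] by auto
    from transversal_path_extend[OF T S t N w us(1-3) inj this, where A' = A] us(4)
    show "\<exists>w'. transversal_path G S N (generate G (insert t T)) A w' \<and> even (length w')" by auto
  qed
qed

lemma transversal_path_singleton: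
  assumes "T \<subseteq> carrier G"
  shows "transversal_path G S (generate G T) (generate G T) (generate G T) [\<one>]"
  using generate.one[of G T] generate_in_carrier[OF assms] by (auto simp: transversal_path_def)

text \<open>
  The first case is that of finite index. Otherwise some generator has infinite order modulo the
  previous ones, and the range of its exponent can be chosen of even length.
\<close>

theorem transversal_path_dichotomy:
  assumes "finite S" "S \<subseteq> carrier G" "R \<subseteq> S"
  shows "(\<exists>w. transversal_path G S (generate G R) (generate G S) (generate G S) w) \<or>
    (\<forall>A. finite A \<longrightarrow> A \<subseteq> generate G S \<longrightarrow>
       (\<exists>w. transversal_path G S (generate G R) (generate G S) A w \<and> even (length w)))"
proof -
  define P where "P T \<longleftrightarrow>
    (\<exists>w. transversal_path G S (generate G R) (generate G T) (generate G T) w) \<or>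
    (\<forall>A. finite A \<longrightarrow> A \<subseteq> generate G T \<longrightarrow>
       (\<exists>w. transversal_path G S (generate G R) (generate G T) A w \<and> even (length w)))" for T
  have "finite (S - R)" using assms(1) by simp
  moreover have "S - R \<subseteq> S" by auto
  ultimately have "P ((S - R) \<union> R)"
  proof (induction rule: finite_subset_induct')
    case empty
    show ?case using transversal_path_singleton[of R S] assms unfolding P_def by auto
  next
    case (insert t Q)
    let ?T = "Q \<union> R"
    have T: "?T \<subseteq> carrier G" using insert assms by auto
    have N: "subgroup (generate G R) G" "generate G R \<subseteq> generate G ?T"
      using generate_is_subgroup[of R] assms mono_generate[of R ?T] by auto
    note hyps = T assms(2) insert(2) N
    have "P (insert t ?T)"
    proof (cases "\<exists>k :: nat. k > 0 \<and> t [^] k \<in> generate G ?T")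
      case True
      then obtain k :: nat where k: "t [^] k \<in> generate G ?T" "k > 0" by blast
      obtain I m where I: "finite I" and
        m: "\<And>A w. A \<subseteq> generate G (insert t ?T) \<Longrightarrow>
          transversal_path G S (generate G R) (generate G ?T)
            ((\<lambda>(i :: int, x). inv (t [^] i) \<otimes> x) ` (I \<times> A) \<inter> generate G ?T) w \<Longrightarrow>
          \<exists>w'. transversal_path G S (generate G R) (generate G (insert t ?T)) A w' \<and> length w' = m * length w"
        using transversal_path_extend_torsion[OF hyps k] by blast
      from insert.IH[unfolded P_def] show ?thesis
      proof (elim disjE exE)
        fix w assume "transversal_path G S (generate G R) (generate G ?T) (generate G ?T) w"
        then show ?thesis unfolding P_def
          using m[OF order_refl transversal_path_mono, of "generate G ?T" w] by auto
      next
        assume IH: "\<forall>A. finite A \<longrightarrow> A \<subseteq> generate G ?T \<longrightarrow>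
          (\<exists>w. transversal_path G S (generate G R) (generate G ?T) A w \<and> even (length w))"
        have "\<exists>w. transversal_path G S (generate G R) (generate G (insert t ?T)) A w \<and> even (length w)"
          if A: "finite A" "A \<subseteq> generate G (insert t ?T)" for A
        proof -
          let ?A' = "(\<lambda>(i :: int, x). inv (t [^] i) \<otimes> x) ` (I \<times> A) \<inter> generate G ?T"
          have "finite ?A'" "?A' \<subseteq> generate G ?T" using A I by auto
          then obtain w where "transversal_path G S (generate G R) (generate G ?T) ?A' w" "even (length w)"
            using IH by blast
          then show ?thesis using m[OF A(2)] by (metis even_mult_iff)
        qed
        then show ?thesis unfolding P_def by blast
      qed
    next
      case False
      then have free: "t [^] k \<notin> generate G ?T" if "k > 0" for k :: nat using that by blast
      \<comment> \<open>Paths for finite sets are all that the free step asks for, and either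
        alternative of the induction hypothesis provides them.\<close>
      have "\<exists>w. transversal_path G S (generate G R) (generate G ?T) A w"
        if "finite A" "A \<subseteq> generate G ?T" for A
        using insert.IH that unfolding P_def transversal_path_def by (meson subsetD)
      then show ?thesis unfolding P_def
        using transversal_path_extend_free[OF hyps free] by meson
    qed
    then show ?case by simp
  qed
  moreover have "(S - R) \<union> R = S" using assms(3) by auto
  ultimately show ?thesis unfolding P_def by simp
qed

end

section \<open>Grids in the group and their covering walks\<close>

context comm_group
begin

text \<open>Every element of \<open>A\<close> is a power of \<open>s\<close> times a representative
  modulo \<open>\<langle>s\<rangle>\<close>, so a long enough range of exponents captures
  \<open>A\<close>. Different cosets and the infinite order of \<open>s\<close> make
  \<open>g\<close> injective on the rectangle, which turns bounds in terms of its area into bounds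
  in terms of \<open>card F\<close>. Adjacency is restricted to \<open>F\<close> so that the walks
  also prove the induced subgraph connected.\<close>

lemma transversal_box:
  assumes S: "S \<subseteq> carrier G" and s: "s \<in> S" and free: "\<And>k :: int. s [^] k = \<one> \<Longrightarrow> k = 0"
    and A: "finite A" "A \<subseteq> carrier G"
    and w: "transversal_path G S (generate G {s}) (carrier G) A w"
  obtains n F g where "finite F" "A \<subseteq> F" "F \<subseteq> carrier G" "card F = 2 * n * length w"
    "F = case_prod g ` ({..<2 * n} \<times> {..<length w})"
    "grid (\<lambda>x y. x \<in> F \<and> y \<in> F \<and> cay_adj G S x y) g (2 * n) (length w)"
proof -
  have sG: "s \<in> carrier G" using S s by auto
  have wG: "w ! j \<in> carrier G" if "j < length w" for j
    using w that by (auto simp: transversal_path_def)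
  have gen: "generate G {s} = {s [^] k | k :: int. k \<in> UNIV}" using generate_pow[OF sG] .
  have "\<exists>j k. j < length w \<and> x = s [^] (k :: int) \<otimes> w ! j" if x: "x \<in> A" for x
  proof -
    obtain y where y: "y \<in> set w" "x \<otimes> inv y \<in> generate G {s}"
      using w x by (auto simp: transversal_path_def)
    then obtain k :: int where k: "x \<otimes> inv y = s [^] k" using gen by auto
    obtain j where j: "j < length w" "y = w ! j" using y(1) by (auto simp: in_set_conv_nth)
    have "x = (x \<otimes> inv y) \<otimes> y" using x A(2) wG j by (auto simp: m_assoc)
    then show ?thesis using j k by metis
  qed
  then obtain \<beta> \<kappa> where \<kappa>: "\<And>x. x \<in> A \<Longrightarrow> \<beta> x < length w \<and> x = s [^] (\<kappa> x :: int) \<otimes> w ! (\<beta> x)" by metis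
  define n where "n = Suc (\<Sum>x\<in>A. nat \<bar>\<kappa> x\<bar>)"
  have n: "\<bar>\<kappa> x\<bar> < int n" if "x \<in> A" for x
    using member_le_sum[of x A "\<lambda>x. nat \<bar>\<kappa> x\<bar>"] A(1) that unfolding n_def by linarith
  define g where "g i j = s [^] (int i - int n) \<otimes> w ! j" for i j
  define F where "F = case_prod g ` ({..<2 * n} \<times> {..<length w})"
  have gG: "g i j \<in> carrier G" if "j < length w" for i j using that wG sG by (simp add: g_def)
  have "A \<subseteq> F"
  proof
    fix x assume x: "x \<in> A"
    have "0 \<le> \<kappa> x + int n" using n[OF x] by linarith
    then have "x = g (nat (\<kappa> x + int n)) (\<beta> x)" using \<kappa>[OF x] by (simp add: g_def)
    moreover have "nat (\<kappa> x + int n) < 2 * n" using n[OF x] by linarith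
    moreover have "\<beta> x < length w" using \<kappa>[OF x] by simp
    ultimately show "x \<in> F" unfolding F_def by (metis SigmaI case_prod_conv image_eqI lessThan_iff)
  qed
  have inj: "inj_on (case_prod g) ({..<2 * n} \<times> {..<length w})"
  proof (rule inj_onI, clarify)
    fix i j i' j' assume j: "j < length w" "j' < length w" and eq: "g i j = g i' j'"
    have "w ! j \<otimes> inv (w ! j') = s [^] (int i' - int i)"
    proof -
      have "s [^] (int i' - int i) \<otimes> w ! j' = s [^] ((int i' - int n) - (int i - int n)) \<otimes> w ! j'" by simp
      also have "\<dots> = inv (s [^] (int i - int n)) \<otimes> g i' j'"
        using wG[OF j(2)] sG unfolding g_def by (simp only: int_pow_diff[OF sG]) (simp add: m_ac)
      also have "\<dots> = w ! j"
        using wG[OF j(1)] sG unfolding eq[symmetric] by (simp add: g_def flip: m_assoc)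
      finally have "w ! j = s [^] (int i' - int i) \<otimes> w ! j'" by simp
      then show ?thesis using wG[OF j(2)] sG by (simp add: m_assoc)
    qed
    then have *: "w ! j \<otimes> inv (w ! j') \<in> generate G {s}" using gen by auto
    then have "w ! j = w ! j'" using w j by (auto simp: transversal_path_def)
    then have "j = j'" using w j by (auto simp: transversal_path_def nth_eq_iff_index_eq)
    then have "s [^] (int i' - int i) = \<one>"
      using \<open>w ! j \<otimes> inv (w ! j') = _\<close> wG[OF j(2)] by simp
    then show "i = i' \<and> j = j'" using free[of "int i' - int i"] \<open>j = j'\<close> by simp
  qed
  have "grid (\<lambda>x y. x \<in> F \<and> y \<in> F \<and> cay_adj G S x y) g (2 * n) (length w)"
  proof
    show "symp (\<lambda>x y. x \<in> F \<and> y \<in> F \<and> cay_adj G S x y)"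
      using symp_cay_adj[of G S] by (auto simp: symp_def)
    show "g i j \<in> F \<and> g (Suc i) j \<in> F \<and> cay_adj G S (g i j) (g (Suc i) j)"
      if "Suc i < 2 * n" "j < length w" for i j
    proof -
      have "int (Suc i) - int n = (int i - int n) + 1" by simp
      then have "g (Suc i) j = g i j \<otimes> s"
        using sG wG[OF that(2)] unfolding g_def by (simp only: int_pow_mult int_pow_1 int_pow_closed m_ac)
      then have "cay_adj G S (g i j) (g (Suc i) j)"
        using gG that s unfolding cay_adj_def by blast
      then show ?thesis using that by (auto simp: F_def)
    qed
    show "g i j \<in> F \<and> g i (Suc j) \<in> F \<and> cay_adj G S (g i j) (g i (Suc j))"
      if "i < 2 * n" "Suc j < length w" for i j
    proof -
      have "cay_adj G S (w ! j) (w ! Suc j)"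
        using w that by (auto simp: transversal_path_def successively_conv_nth)
      then have "cay_adj G S (g i j) (g i (Suc j))"
        using sG S unfolding cay_adj_def g_def by (auto simp: m_assoc subset_iff)
      then show ?thesis using that by (auto simp: F_def)
    qed
  qed
  moreover have "F \<subseteq> carrier G" using gG by (auto simp: F_def)
  moreover have "card F = 2 * n * length w"
    unfolding F_def using card_image[OF inj] by (simp add: card_cartesian_product)
  moreover have "finite F" by (simp add: F_def)
  ultimately show thesis using \<open>A \<subseteq> F\<close> F_def by (intro that[of F n g])
qed

theorem covering_walks_cayley:
  assumes S: "finite S" "S \<subseteq> carrier G" "generate G S = carrier G"
    and s: "s \<in> S" "\<And>k :: int. s [^] k = \<one> \<Longrightarrow> k = 0" "generate G {s} \<noteq> carrier G"
  shows "\<exists>M. \<forall>A. finite A \<and> A \<subseteq> carrier G \<longrightarrow> (\<exists>F. finite F \<and> A \<subseteq> F \<and> F \<subseteq> carrier G \<and>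
    (\<forall>u \<in> F. \<forall>v \<in> F. cov_walk (\<lambda>x y. x \<in> F \<and> y \<in> F \<and> cay_adj G S x y) F u v (card F + M)))"
proof -
  have sG: "s \<in> carrier G" using S s by auto
  consider (fin) w where "transversal_path G S (generate G {s}) (carrier G) (carrier G) w"
    | (inf) "\<And>A. finite A \<Longrightarrow> A \<subseteq> carrier G \<Longrightarrow>
        \<exists>w. transversal_path G S (generate G {s}) (carrier G) A w \<and> even (length w)"
    using transversal_path_dichotomy[of S "{s}"] S s(1) by auto
  then show ?thesis
  proof cases
    case fin
    \<comment> \<open>A path with one vertex would mean a single coset, and \<open>s\<close> would
      generate the whole group.\<close>
    have "length w \<noteq> 1"
    proof
      assume "length w = 1"
      then obtain y where y: "w = [y]" by (cases w) auto
      have yG: "y \<in> carrier G" using fin y by (auto simp: transversal_path_def)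
      have "x \<in> generate G {s}" if "x \<in> carrier G" for x
      proof -
        have "(x \<otimes> y) \<otimes> inv y \<in> generate G {s}"
          using fin yG that by (auto simp: transversal_path_def y)
        then show ?thesis using that yG by (simp add: m_assoc)
      qed
      then show False using s(3) generate_incl[of "{s}"] sG by blast
    qed
    then have len: "2 \<le> length w" using fin by (cases w) (auto simp: transversal_path_def Suc_le_eq)
    show ?thesis
    \<comment> \<open>The same \<open>w\<close> serves every \<open>A\<close>, which only influences
      the range of exponents of \<open>s\<close>; so an error proportional to
      \<open>length w\<close> is still a constant.\<close>
    proof (intro exI[of _ "12 * length w + 6"] allI impI, elim conjE)
      fix A assume A: "finite A" "A \<subseteq> carrier G"
      obtain n F g where
        F: "finite F" "A \<subseteq> F" "F \<subseteq> carrier G" "card F = 2 * n * length w"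
          "F = case_prod g ` ({..<2 * n} \<times> {..<length w})"
          "grid (\<lambda>x y. x \<in> F \<and> y \<in> F \<and> cay_adj G S x y) g (2 * n) (length w)"
        by (rule transversal_box[OF S(2) s(1,2) A transversal_path_mono[OF fin A(2)]])
      show "\<exists>F. finite F \<and> A \<subseteq> F \<and> F \<subseteq> carrier G \<and> (\<forall>u \<in> F. \<forall>v \<in> F.
        cov_walk (\<lambda>x y. x \<in> F \<and> y \<in> F \<and> cay_adj G S x y) F u v (card F + (12 * length w + 6)))"
        using F(1-4) grid.narrow_grid_walk[OF F(6) len, folded F(5)] by (intro exI[of _ F]) simp
    qed
  next
    case inf
    show ?thesis
    \<comment> \<open>Here \<open>w\<close> depends on \<open>A\<close>, so the error must be
      independent of \<open>length w\<close>.\<close>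
    proof (intro exI[of _ "46"] allI impI, elim conjE)
      fix A assume A: "finite A" "A \<subseteq> carrier G"
      from inf[OF A] obtain w l where w: "transversal_path G S (generate G {s}) (carrier G) A w"
        and l: "length w = 2 * l" by (auto elim: evenE)
      obtain n F g where
        F: "finite F" "A \<subseteq> F" "F \<subseteq> carrier G" "card F = 2 * n * length w"
          "F = case_prod g ` ({..<2 * n} \<times> {..<length w})"
          "grid (\<lambda>x y. x \<in> F \<and> y \<in> F \<and> cay_adj G S x y) g (2 * n) (length w)"
        by (rule transversal_box[OF S(2) s(1,2) A w])
      show "\<exists>F. finite F \<and> A \<subseteq> F \<and> F \<subseteq> carrier G \<and> (\<forall>u \<in> F. \<forall>v \<in> F.
        cov_walk (\<lambda>x y. x \<in> F \<and> y \<in> F \<and> cay_adj G S x y) F u v (card F + 46))"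
        using F(1-4) even_grid_walk[OF F(6)[unfolded l], folded l, folded F(5)]
        by (intro exI[of _ F]) simp
    qed
  qed
qed

section \<open>Generators of infinite order\<close>

lemma finite_generate_torsion:
  assumes "finite S" "S \<subseteq> carrier G" "\<And>s. s \<in> S \<Longrightarrow> \<exists>k :: nat. k > 0 \<and> s [^] k = \<one>"
  shows "finite (generate G S)"
  using assms
proof (induction rule: finite_induct)
  case empty
  show ?case by (simp add: generate_empty)
next
  case (insert t T)
  then obtain k :: nat where k: "k > 0" "t [^] k = \<one>" by auto
  have T: "T \<subseteq> carrier G" and t: "t \<in> carrier G" using insert.prems by auto
  \<comment> \<open>Exponents of \<open>t\<close> can be reduced modulo \<open>k\<close>, so adding
    \<open>t\<close> enlarges the subgroup at most by the factor \<open>k\<close>.\<close>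
  have "generate G (insert t T) \<subseteq> (\<lambda>(i, h). t [^] i \<otimes> h) ` ({0..<int k} \<times> generate G T)"
  proof
    fix x assume "x \<in> generate G (insert t T)"
    then obtain j :: int and h where h: "h \<in> generate G T" "x = t [^] j \<otimes> h"
      using generate_insert[OF T t] by blast
    have "t [^] (int k * (j div int k) + j mod int k) = t [^] (j mod int k)"
      using t k by (simp only: int_pow_mult) (simp flip: int_pow_pow add: int_pow_int)
    then have "t [^] j = t [^] (j mod int k)" by simp
    then show "x \<in> (\<lambda>(i, h). t [^] i \<otimes> h) ` ({0..<int k} \<times> generate G T)"
      using h k(1) by (auto intro!: image_eqI[of _ _ "(j mod int k, h)"])
  qed
  moreover have "finite (generate G T)" using insert by auto
  ultimately show ?case by (meson finite_SigmaI finite_atLeastLessThan_int finite_imageI finite_subset)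
qed

lemma infinite_order_generator:
  assumes "finite S" "S \<subseteq> carrier G" "infinite (generate G S)"
  obtains s where "s \<in> S" "\<And>k :: int. s [^] k = \<one> \<Longrightarrow> k = 0"
proof -
  obtain s where s: "s \<in> S" "\<And>k :: nat. k > 0 \<Longrightarrow> s [^] k \<noteq> \<one>"
    using finite_generate_torsion[OF assms(1,2)] assms(3) by blast
  have sG: "s \<in> carrier G" using s assms by auto
  have "k = 0" if k: "s [^] k = \<one>" for k :: int
  proof (rule ccontr)
    assume "k \<noteq> 0"
    have "s [^] (- k) = \<one>" using k sG by (simp add: int_pow_neg)
    then have "s [^] \<bar>k\<bar> = \<one>" using k by (simp add: abs_if)
    then have "s [^] nat \<bar>k\<bar> = \<one>" by (metis abs_ge_zero int_nat_eq int_pow_int)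
    then show False using s(2)[of "nat \<bar>k\<bar>"] \<open>k \<noteq> 0\<close> by simp
  qed
  then show thesis using that s(1) by blast
qed

end

section \<open>Cayley graphs\<close>

lemma vwalk_iff_successively:
  "vwalk p G \<longleftrightarrow> p \<noteq> [] \<and> set p \<subseteq> verts G \<and> successively (\<lambda>x y. (x, y) \<in> arcs_ends G) p"
proof -
  have "set (vwalk_arcs p) \<subseteq> R \<longleftrightarrow> successively (\<lambda>x y. (x, y) \<in> R) p" for R :: "('a \<times> 'a) set"
    by (induction p rule: vwalk_arcs.induct) auto
  then show ?thesis by (auto simp: vwalk_def)
qed

lemma pverts_Cay [simp]: "pverts (Cay B S) = carrier B"
  by (simp add: Cay_def)

lemma parcs_Cay:
  assumes "group B" "S \<subseteq> carrier B"
  shows "(x, y) \<in> parcs (Cay B S) \<longleftrightarrow> x \<noteq> y \<and> cay_adj B S x y"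
proof -
  interpret group B by fact
  have "x = y \<otimes>\<^bsub>B\<^esub> inv\<^bsub>B\<^esub> s \<longleftrightarrow> y = x \<otimes>\<^bsub>B\<^esub> s" if "x \<in> carrier B" "y \<in> carrier B" "s \<in> S" for s
    using that assms(2) by (auto simp: m_assoc subset_iff)
  then show ?thesis by (auto simp: Cay_def cay_adj_def)
qed

lemma pair_bidirected_digraph_Cay:
  assumes "group B" "S \<subseteq> carrier B"
  shows "pair_bidirected_digraph (Cay B S)"
proof
  fix e assume e: "e \<in> parcs (Cay B S)"
  then show "fst e \<in> pverts (Cay B S)" "snd e \<in> pverts (Cay B S)" "fst e \<noteq> snd e"
    by (auto simp: Cay_def)
next
  show "symmetric (with_proj (Cay B S))"
    using parcs_Cay[OF assms] symp_cay_adj[of B S] by (auto simp: symmetric_def sym_def symp_def)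
qed

lemma locally_finite_Cay:
  assumes "group B" "finite S" "S \<subseteq> carrier B"
  shows "locally_finite (Cay B S)"
  unfolding locally_finite_def
proof
  interpret group B by fact
  fix v
  have "out_arcs (with_proj (Cay B S)) v \<subseteq> (\<lambda>s. (v, v \<otimes>\<^bsub>B\<^esub> s)) ` (S \<union> m_inv B ` S)"
  proof
    fix e assume "e \<in> out_arcs (with_proj (Cay B S)) v"
    then obtain x where e: "e = (v, x)" "(v, x) \<in> parcs (Cay B S)" by (cases e) auto
    then obtain s where s: "v \<in> carrier B" "x \<in> carrier B" "s \<in> S" "x = v \<otimes>\<^bsub>B\<^esub> s \<or> v = x \<otimes>\<^bsub>B\<^esub> s"
      using parcs_Cay[OF assms(1,3)] by (auto simp: cay_adj_def)
    then have "x = v \<otimes>\<^bsub>B\<^esub> s \<or> x = v \<otimes>\<^bsub>B\<^esub> inv\<^bsub>B\<^esub> s" using assms(3) by (auto simp: m_assoc subset_iff)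
    then show "e \<in> (\<lambda>s. (v, v \<otimes>\<^bsub>B\<^esub> s)) ` (S \<union> m_inv B ` S)" using e s(3) by auto
  qed
  then show "finite (out_arcs (with_proj (Cay B S)) v)"
    using assms(2) by (meson finite_UnI finite_imageI finite_subset)
qed

lemma finite_graph_ball:
  assumes "locally_finite \<Gamma>"
  shows "finite (graph_ball \<Gamma> u n)"
proof (induction n)
  case 0
  have "last p = hd p" if "vwalk p (with_proj \<Gamma>)" "vwalk_length p \<le> 0" for p
    using that by (cases p) (auto simp: vwalk_def)
  then have "graph_ball \<Gamma> u 0 \<subseteq> {u}" unfolding graph_ball_def by blast
  then show ?case using finite_subset by blast
next
  case (Suc n)
  have "graph_ball \<Gamma> u (Suc n) \<subseteq>
    graph_ball \<Gamma> u n \<union> snd ` (\<Union>v \<in> graph_ball \<Gamma> u n \<inter> pverts \<Gamma>. out_arcs (with_proj \<Gamma>) v)"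
  proof
    fix x assume "x \<in> graph_ball \<Gamma> u (Suc n)"
    then obtain p where p: "vwalk p (with_proj \<Gamma>)" "hd p = u" "last p = x" "length p \<le> Suc (Suc n)"
      by (auto simp: graph_ball_def)
    show "x \<in> graph_ball \<Gamma> u n \<union> snd ` (\<Union>v \<in> graph_ball \<Gamma> u n \<inter> pverts \<Gamma>. out_arcs (with_proj \<Gamma>) v)"
    proof (cases "length p \<le> Suc n")
      case True
      then show ?thesis using p by (auto simp: graph_ball_def)
    next
      case False
      define q where "q = butlast p"
      have "p \<noteq> []" using False by auto
      then have "p = q @ [x]" using p(3) append_butlast_last_id[of p] by (simp add: q_def)
      moreover from this have "q \<noteq> []" using False by auto
      ultimately have q: "p = q @ [x]" "q \<noteq> []" by auto
      then have "vwalk q (with_proj \<Gamma>)" "(last q, x) \<in> parcs \<Gamma>" "last q \<in> pverts \<Gamma>"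
        using p(1) by (auto simp: vwalk_iff_successively successively_append_iff)
      moreover have "last q \<in> graph_ball \<Gamma> u n"
        using q p(2,4) \<open>vwalk q _\<close> by (auto simp: graph_ball_def)
      ultimately have "x \<in> snd ` out_arcs (with_proj \<Gamma>) (last q)" "last q \<in> graph_ball \<Gamma> u n \<inter> pverts \<Gamma>"
        by (auto simp: image_iff intro!: bexI[of _ "(last q, x)"])
      then show ?thesis by blast
    qed
  qed
  moreover have "finite \<dots>"
    using Suc.IH assms unfolding locally_finite_def
    by (intro finite_UnI finite_imageI finite_UN_I finite_Int disjI1) auto
  ultimately show ?case by (rule finite_subset)
qed

lemma connected_if_walks:
  assumes "verts G \<noteq> {}"
    and "\<And>u v. u \<in> verts G \<Longrightarrow> v \<in> verts G \<Longrightarrow> \<exists>p. vwalk p G \<and> hd p = u \<and> last p = v"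
  shows "Digraph_Component.connected G"
proof -
  have "(hd p, last p) \<in> rtrancl_on (verts G) (symcl (arcs_ends G))" if "vwalk p G" for p
    using that
  proof (induction p rule: list.induct)
    case (Cons x p)
    show ?case
    proof (cases "p = []")
      case True
      then show ?thesis using Cons.prems by (auto simp: vwalk_def)
    next
      case False
      then have "(x, hd p) \<in> symcl (arcs_ends G)" "vwalk p G" "x \<in> verts G"
        using Cons.prems by (auto simp: vwalk_iff_successively successively_Cons symcl_def)
      then show ?thesis
        using Cons.IH False by (auto intro: converse_rtrancl_on_into_rtrancl_on)
    qed
  qed (simp add: vwalk_def)
  then have "(u, v) \<in> rtrancl_on (verts G) (symcl (arcs_ends G))" if "u \<in> verts G" "v \<in> verts G" for u v
    using assms(2)[OF that] by blast
  then show ?thesis using assms(1) unfolding connected_conv by blast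
qed

text \<open>\<open>remdups_adj\<close> deletes the loops caused by the identity in \<open>S\<close>,
  preserving the end points and the set of vertices and never lengthening the list. The same list is
  a walk in both graphs: the whole graph is the one in which \<open>TS\<close> is measured, the
  induced subgraph the one whose connectedness is required.\<close>

lemma cov_walk_imp_vwalk:
  assumes "group B" "S \<subseteq> carrier B" "F \<subseteq> carrier B" "u \<in> F"
    and "cov_walk (\<lambda>x y. x \<in> F \<and> y \<in> F \<and> cay_adj B S x y) F u v n"
  obtains p where "vwalk p (with_proj (Cay B S))" "vwalk p (induce_subgraph (with_proj (Cay B S)) F)"
    "hd p = u" "last p = v" "F \<subseteq> set p" "length p \<le> n"
proof -
  let ?E = "\<lambda>x y. x \<in> F \<and> y \<in> F \<and> cay_adj B S x y"
  obtain p where p: "p \<noteq> []" "hd p = u" "last p = v" "successively ?E p" "F \<subseteq> set p" "length p \<le> n"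
    using assms(5) unfolding cov_walk_def by blast
  define q where "q = remdups_adj p"
  have "successively ?E q" unfolding q_def using p(4) by (rule successively_remdups_adjI)
  moreover have "q ! i \<noteq> q ! Suc i" if "Suc i < length q" for i
    using that unfolding q_def by (rule remdups_adj_adjacent)
  ultimately have q: "successively (\<lambda>x y. x \<in> F \<and> y \<in> F \<and> (x, y) \<in> parcs (Cay B S)) q"
    by (auto simp: successively_conv_nth parcs_Cay[OF assms(1,2)])
  have "set p \<subseteq> F"
    using p(1,2,4) assms(4)
  proof (induction p arbitrary: u rule: list.induct)
    case (Cons x p)
    then show ?case by (cases p) auto
  qed simp
  moreover have "arcs_ends (induce_subgraph (with_proj (Cay B S)) F) =
      {(x, y). x \<in> F \<and> y \<in> F \<and> (x, y) \<in> parcs (Cay B S)}"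
    by (auto simp: arcs_ends_conv image_iff)
  moreover have "successively (\<lambda>x y. (x, y) \<in> parcs (Cay B S)) q"
    using q by (rule successively_mono) auto
  moreover have "length q \<le> n" unfolding q_def using order_trans[OF remdups_adj_length p(6)] .
  ultimately show thesis
    using p q assms(3) by (intro that[of q]) (simp_all add: vwalk_iff_successively q_def)
qed

lemma quasi_hamiltonian_Cay:
  assumes "group B" "infinite (carrier B)" "finite S" "S \<subseteq> carrier B"
    and "\<exists>M. \<forall>A. finite A \<and> A \<subseteq> carrier B \<longrightarrow> (\<exists>F. finite F \<and> A \<subseteq> F \<and> F \<subseteq> carrier B \<and>
      (\<forall>u \<in> F. \<forall>v \<in> F. cov_walk (\<lambda>x y. x \<in> F \<and> y \<in> F \<and> cay_adj B S x y) F u v (card F + M)))"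
  shows "quasi_hamiltonian (Cay B S) \<one>\<^bsub>B\<^esub>"
proof -
  interpret group B by fact
  obtain M where walks: "\<forall>A. finite A \<and> A \<subseteq> carrier B \<longrightarrow> (\<exists>F. finite F \<and> A \<subseteq> F \<and> F \<subseteq> carrier B \<and>
      (\<forall>u \<in> F. \<forall>v \<in> F. cov_walk (\<lambda>x y. x \<in> F \<and> y \<in> F \<and> cay_adj B S x y) F u v (card F + M)))"
    using assms(5) by (elim exE)
  let ?\<Gamma> = "Cay B S"
  define \<F> where "\<F> = {F. finite F \<and> F \<subseteq> carrier B \<and> \<one>\<^bsub>B\<^esub> \<in> F \<and>
    (\<forall>u \<in> F. \<forall>v \<in> F. cov_walk (\<lambda>x y. x \<in> F \<and> y \<in> F \<and> cay_adj B S x y) F u v (card F + M))}"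
  have \<F>: "\<exists>F \<in> \<F>. A \<subseteq> F" if "finite A" "A \<subseteq> carrier B" for A
  proof -
    have A': "finite (insert \<one>\<^bsub>B\<^esub> A) \<and> insert \<one>\<^bsub>B\<^esub> A \<subseteq> carrier B" using that by simp
    obtain F where "finite F" "insert \<one>\<^bsub>B\<^esub> A \<subseteq> F" "F \<subseteq> carrier B"
      "\<forall>u \<in> F. \<forall>v \<in> F. cov_walk (\<lambda>x y. x \<in> F \<and> y \<in> F \<and> cay_adj B S x y) F u v (card F + M)"
      using walks[rule_format, OF A'] by (elim exE conjE)
    then show ?thesis by (intro bexI[of _ F]) (simp_all add: \<F>_def)
  qed
  have vw: "\<exists>p. vwalk p (with_proj ?\<Gamma>) \<and> vwalk p (induce_subgraph (with_proj ?\<Gamma>) F) \<and>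
      hd p = u \<and> last p = v \<and> F \<subseteq> set p \<and> length p \<le> card F + M" if "F \<in> \<F>" "u \<in> F" "v \<in> F" for F u v
  proof -
    have F: "F \<subseteq> carrier B" "cov_walk (\<lambda>x y. x \<in> F \<and> y \<in> F \<and> cay_adj B S x y) F u v (card F + M)"
      using that by (simp_all add: \<F>_def)
    show ?thesis by (rule cov_walk_imp_vwalk[OF assms(1,4) F(1) that(2) F(2)]) (intro exI conjI)
  qed
  have conn: "Digraph_Component.connected (with_proj ?\<Gamma>)"
  proof (rule connected_if_walks)
    show "verts (with_proj ?\<Gamma>) \<noteq> {}" using one_closed by auto
    fix u v assume "u \<in> verts (with_proj ?\<Gamma>)" "v \<in> verts (with_proj ?\<Gamma>)"
    then obtain F where "F \<in> \<F>" "u \<in> F" "v \<in> F" using \<F>[of "{u, v}"] by auto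
    then show "\<exists>p. vwalk p (with_proj ?\<Gamma>) \<and> hd p = u \<and> last p = v" using vw by blast
  qed
  have induced_conn: "Digraph_Component.connected (induce_subgraph (with_proj ?\<Gamma>) F)" if "F \<in> \<F>" for F
  proof (rule connected_if_walks)
    show "verts (induce_subgraph (with_proj ?\<Gamma>) F) \<noteq> {}" using that by (auto simp: \<F>_def)
    show "\<exists>p. vwalk p (induce_subgraph (with_proj ?\<Gamma>) F) \<and> hd p = u \<and> last p = v"
      if "u \<in> verts (induce_subgraph (with_proj ?\<Gamma>) F)" "v \<in> verts (induce_subgraph (with_proj ?\<Gamma>) F)" for u v
      using vw[OF \<open>F \<in> \<F>\<close>, of u v] that unfolding induce_subgraph_verts by blast
  qed
  have TS_le: "TS ?\<Gamma> \<one>\<^bsub>B\<^esub> x F \<le> enat (card F + M)" if F: "F \<in> \<F>" and x: "x \<in> F" for F x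
  proof -
    have "\<one>\<^bsub>B\<^esub> \<in> F" using F by (simp add: \<F>_def)
    with vw[OF F _ x] obtain p where p: "vwalk p (with_proj ?\<Gamma>)" "hd p = \<one>\<^bsub>B\<^esub>" "last p = x"
      "F \<subseteq> set p" "length p \<le> card F + M" by blast
    then have "TS ?\<Gamma> \<one>\<^bsub>B\<^esub> x F \<le> enat (length p)" unfolding TS_def by (intro INF_lower) auto
    also have "\<dots> \<le> enat (card F + M)" using p(5) by simp
    finally show ?thesis .
  qed
  have ball: "\<exists>F \<in> \<F>. graph_ball ?\<Gamma> \<one>\<^bsub>B\<^esub> n \<subseteq> F" for n
  proof (rule \<F>)
    show "finite (graph_ball ?\<Gamma> \<one>\<^bsub>B\<^esub> n)" using finite_graph_ball locally_finite_Cay[OF assms(1,3,4)] .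
    show "graph_ball ?\<Gamma> \<one>\<^bsub>B\<^esub> n \<subseteq> carrier B"
    proof
      fix x assume "x \<in> graph_ball ?\<Gamma> \<one>\<^bsub>B\<^esub> n"
      then obtain p where "vwalk p (with_proj ?\<Gamma>)" "last p = x" by (auto simp: graph_ball_def)
      then show "x \<in> carrier B" using last_in_set[of p] by (auto simp: vwalk_def)
    qed
  qed
  show ?thesis
    unfolding quasi_hamiltonian_def pverts_Cay
  proof (intro conjI exI[of _ \<F>] exI[of _ M] ballI allI impI)
    show "pair_bidirected_digraph ?\<Gamma>" by (rule pair_bidirected_digraph_Cay[OF assms(1,4)])
    show "locally_finite ?\<Gamma>" by (rule locally_finite_Cay[OF assms(1,3,4)])
    show "\<one>\<^bsub>B\<^esub> \<in> carrier B" by (rule one_closed)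
    show "F \<subseteq> carrier B" "finite F" "\<one>\<^bsub>B\<^esub> \<in> F" if "F \<in> \<F>" for F
      using that by (simp_all add: \<F>_def)
  qed ((rule assms(2) conn induced_conn ball TS_le; assumption)+)
qed

section \<open>The excluded graph: the two-way infinite line\<close>

lemma Cay_line:
  assumes "group B" "s \<in> S" "S \<subseteq> {\<one>\<^bsub>B\<^esub>, s, inv\<^bsub>B\<^esub> s}" "S \<subseteq> carrier B"
    and free: "\<And>k :: int. s [^]\<^bsub>B\<^esub> k = \<one>\<^bsub>B\<^esub> \<Longrightarrow> k = 0"
    and gen: "generate B {s} = carrier B"
  shows "digraph_iso (with_proj (Cay B S)) (with_proj (Cay integer_group {1, -1}))"
proof -
  interpret group B by fact
  have sG: "s \<in> carrier B" using assms by auto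
  define \<phi> where "\<phi> = (\<lambda>k :: int. s [^]\<^bsub>B\<^esub> k)"
  have inj: "inj \<phi>"
  proof (rule injI)
    fix k l assume "\<phi> k = \<phi> l"
    then have "s [^]\<^bsub>B\<^esub> (k - l) = \<one>\<^bsub>B\<^esub>" using sG by (simp add: \<phi>_def int_pow_diff)
    then show "k = l" using free[of "k - l"] by simp
  qed
  have range: "range \<phi> = carrier B" using generate_pow[OF sG] gen by (auto simp: \<phi>_def)
  define \<psi> where "\<psi> = inv_into UNIV \<phi>"
  have \<psi>\<phi>: "\<psi> (\<phi> k) = k" for k using inj by (simp add: \<psi>_def)
  have \<phi>\<psi>: "\<phi> (\<psi> x) = x" if "x \<in> carrier B" for x using that range by (simp add: \<psi>_def f_inv_into_f)
  have mult: "\<phi> k \<otimes>\<^bsub>B\<^esub> s = \<phi> (k + 1)" "\<phi> k \<otimes>\<^bsub>B\<^esub> inv\<^bsub>B\<^esub> s = \<phi> (k - 1)" for k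
    using sG by (simp_all add: \<phi>_def int_pow_mult int_pow_diff)
  have \<phi>B: "\<phi> k \<in> carrier B" for k using range by auto
  have adj: "(\<phi> k, \<phi> l) \<in> parcs (Cay B S) \<longleftrightarrow> (k, l) \<in> parcs (Cay integer_group {1, -1})" for k l
  proof -
    have "(\<phi> k, \<phi> l) \<in> parcs (Cay B S) \<longleftrightarrow> l = k + 1 \<or> k = l + 1"
    proof
      assume "(\<phi> k, \<phi> l) \<in> parcs (Cay B S)"
      then obtain t where "k \<noteq> l" "t \<in> S" "\<phi> l = \<phi> k \<otimes>\<^bsub>B\<^esub> t \<or> \<phi> k = \<phi> l \<otimes>\<^bsub>B\<^esub> t"
        unfolding parcs_Cay[OF assms(1,4)] cay_adj_def by auto
      moreover from \<open>t \<in> S\<close> have "\<phi> i \<otimes>\<^bsub>B\<^esub> t \<in> {\<phi> i, \<phi> (i + 1), \<phi> (i - 1)}" for i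
        using assms(3) mult[of i] r_one[OF \<phi>B[of i]] by auto
      ultimately have "\<phi> l \<in> {\<phi> k, \<phi> (k + 1), \<phi> (k - 1)} \<or> \<phi> k \<in> {\<phi> l, \<phi> (l + 1), \<phi> (l - 1)}"
        by metis
      then have "l \<in> {k, k + 1, k - 1} \<or> k \<in> {l, l + 1, l - 1}" using inj by (simp add: inj_eq)
      then show "l = k + 1 \<or> k = l + 1" using \<open>k \<noteq> l\<close> by auto
    next
      assume "l = k + 1 \<or> k = l + 1"
      then show "(\<phi> k, \<phi> l) \<in> parcs (Cay B S)"
        unfolding parcs_Cay[OF assms(1,4)] cay_adj_def using \<phi>B assms(2) inj
        by (auto simp: inj_eq mult(1) intro!: bexI[of _ s])
    qed
    moreover have "(k, l) \<in> parcs (Cay integer_group {1, -1}) \<longleftrightarrow> l = k + 1 \<or> k = l + 1"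
      by (auto simp: Cay_def)
    ultimately show ?thesis by simp
  qed
  define f where "f = \<lparr>iso_verts = \<psi>, iso_arcs = map_prod \<psi> \<psi>, iso_head = snd, iso_tail = fst\<rparr>"
  have \<psi>_inj: "inj_on \<psi> (carrier B)" using \<phi>\<psi> by (rule inj_on_inverseI)
  have sub: "parcs (Cay B S) \<subseteq> carrier B \<times> carrier B" by (auto simp: Cay_def)
  interpret C: pair_bidirected_digraph "Cay B S" using pair_bidirected_digraph_Cay[OF assms(1,4)] .
  have "pre_digraph.digraph_isomorphism (with_proj (Cay B S)) f"
    unfolding pre_digraph.digraph_isomorphism_def
    using \<psi>_inj inj_on_subset[OF map_prod_inj_on[OF \<psi>_inj \<psi>_inj] sub] C.wf_digraph
    by (simp add: f_def)
  moreover have "with_proj (Cay integer_group {1, -1}) = app_iso f (with_proj (Cay B S))"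
  proof -
    have "\<psi> ` carrier B = UNIV" unfolding range[symmetric] image_image \<psi>\<phi> by simp
    moreover have "map_prod \<psi> \<psi> ` parcs (Cay B S) = parcs (Cay integer_group {1, -1})"
    proof
      show "map_prod \<psi> \<psi> ` parcs (Cay B S) \<subseteq> parcs (Cay integer_group {1, -1})"
      proof (rule image_subsetI)
        fix e assume e: "e \<in> parcs (Cay B S)"
        then obtain x y where xy: "e = (x, y)" "(x, y) \<in> parcs (Cay B S)" by (cases e) simp
        then have "x \<in> carrier B" "y \<in> carrier B" using sub by auto
        then show "map_prod \<psi> \<psi> e \<in> parcs (Cay integer_group {1, -1})"
          using xy adj[of "\<psi> x" "\<psi> y"] \<phi>\<psi> by simp
      qed
      show "parcs (Cay integer_group {1, -1}) \<subseteq> map_prod \<psi> \<psi> ` parcs (Cay B S)"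
      proof
        fix e assume e: "e \<in> parcs (Cay integer_group {1, -1})"
        obtain k l where kl: "e = (k, l)" by (cases e)
        have "(\<phi> k, \<phi> l) \<in> parcs (Cay B S)" unfolding adj using e kl by simp
        moreover have "e = map_prod \<psi> \<psi> (\<phi> k, \<phi> l)" by (simp add: kl \<psi>\<phi>)
        ultimately show "e \<in> map_prod \<psi> \<psi> ` parcs (Cay B S)" by (rule rev_image_eqI)
      qed
    qed
    ultimately show ?thesis by (simp add: app_iso_def f_def with_proj_def)
  qed
  ultimately show ?thesis unfolding digraph_iso_def by (intro exI conjI)
qed

theorem proposition4p14:
  fixes B :: "('a, 'm) monoid_scheme" and S :: "'a set"
  assumes "comm_group B"
    and "infinite (carrier B)"
    and "finite S" and "S \<subseteq> carrier B" and "generate B S = carrier B"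
    and "\<not> digraph_iso (with_proj (Cay B S)) (with_proj (Cay integer_group {1, -1}))"
  shows "quasi_hamiltonian (Cay B S) \<one>\<^bsub>B\<^esub>"
proof -
  interpret comm_group B by fact
  \<comment> \<open>Otherwise each generator of infinite order generates \<open>B\<close>, and some
    such \<open>s\<close> exists because \<open>B\<close> is infinite. Every
    \<open>t \<in> S\<close> is then \<open>s [^] k\<close>; if \<open>k \<noteq> 0\<close>, it has
    infinite order too and generates \<open>B\<close>, so \<open>s = t [^] l\<close> and
    \<open>k * l = 1\<close>. Thus \<open>S\<close> contains only \<open>s\<close> and possibly its
    inverse and the identity, and the graph is the line.\<close>
  have "\<exists>s \<in> S. (\<forall>k :: int. s [^]\<^bsub>B\<^esub> k = \<one>\<^bsub>B\<^esub> \<longrightarrow> k = 0) \<and> generate B {s} \<noteq> carrier B"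
  proof (rule ccontr)
    assume "\<not> ?thesis"
    then have gen: "generate B {s} = carrier B" if "s \<in> S" "\<And>k :: int. s [^]\<^bsub>B\<^esub> k = \<one>\<^bsub>B\<^esub> \<Longrightarrow> k = 0" for s
      using that by blast
    obtain s where s: "s \<in> S" "\<And>k :: int. s [^]\<^bsub>B\<^esub> k = \<one>\<^bsub>B\<^esub> \<Longrightarrow> k = 0"
      by (rule infinite_order_generator[OF assms(3,4)]) (use assms(2,5) in auto)
    have sG: "s \<in> carrier B" using s assms by auto
    have "t \<in> {\<one>\<^bsub>B\<^esub>, s, inv\<^bsub>B\<^esub> s}" if t: "t \<in> S" for t
    proof -
      have tG: "t \<in> carrier B" using t assms by auto
      have "t \<in> generate B {s}" using tG gen[OF s] by simp
      then obtain k :: int where k: "t = s [^]\<^bsub>B\<^esub> k"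
        unfolding generate_pow[OF sG] by blast
      show ?thesis
      proof (cases "k = 0")
        case False
        have "l = 0" if "t [^]\<^bsub>B\<^esub> l = \<one>\<^bsub>B\<^esub>" for l :: int
          using s(2)[of "k * l"] that sG False unfolding k by (simp add: int_pow_pow)
        then have "s \<in> generate B {t}" using sG gen[OF t] by simp
        then obtain l :: int where "s = t [^]\<^bsub>B\<^esub> l"
          unfolding generate_pow[OF tG] by blast
        then have "s [^]\<^bsub>B\<^esub> (k * l - 1) = \<one>\<^bsub>B\<^esub>"
          using sG unfolding k by (simp add: int_pow_pow int_pow_diff)
        then have "k * l = 1" using s(2)[of "k * l - 1"] by simp
        then have "k = 1 \<or> k = - 1" using zmult_eq_1_iff by blast
        then show ?thesis using k sG by (auto simp: int_pow_neg)
      qed (use k in simp)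
    qed
    then show False
      using Cay_line[OF is_group s(1) _ assms(4) s(2) gen[OF s]] assms(6) by blast
  qed
  then obtain s where s: "s \<in> S" "\<And>k :: int. s [^]\<^bsub>B\<^esub> k = \<one>\<^bsub>B\<^esub> \<Longrightarrow> k = 0" "generate B {s} \<noteq> carrier B"
    by blast
  show ?thesis
    by (rule quasi_hamiltonian_Cay[OF is_group assms(2-4) covering_walks_cayley[OF assms(3-5) s]])
qed

end
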